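(* Let $K$ be an algebraically closed field of characteristic $0$ and let $\mathcal{A}(2,2)$ be the coefficient-free cluster algebra over $K$ generated by cluster variables $x_m$, $m\in\mathbb{Z}$, with $x_{m-1}x_{m+1}=x_m^2+1$. For each $n\ge1$ choose a point $\boldsymbol{a}^{(n)}=(a_1,\dots,a_n)\in(K^\times)^n$ and define \[ x_{(n,-n)}^{\boldsymbol{a}^{(n)}}:=x_0^{-n}x_1^{-n}\sum_{0\le k\le \ell\le n}\sum_{r=0}^{\ell}\binom{\ell-r}{k}\binom{n-2r}{\ell-r}S_{\boldsymbol{a}^{(n)},r}\,x_0^{2(\ell-k)}x_1^{2(n-\ell)},\qquad S_{\boldsymbol{a}^{(n)},r}=\sum_{\substack{I,J\subseteq[1,n]\\ |I|=r=|J|\\ I\cap J=\varnothing}}\frac{\prod_{i\in I}a_i}{\prod_{j\in J}a_j}. \] By a result of Rupel–Stella–Williams, the cluster monomials together with the elements $x_{(n,-n)}^{\boldsymbol{a}^{(n)}}$, $n\ge1$, form a linear basis of $\mathcal{A}(2,2)$. As the points $\boldsymbol{a}^{(n)}$ vary in $(K^\times)^n$, these bases recover precisely all the pointed bases of $\mathcal{A}(2,2)$.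
   Context: An element of $\mathcal{A}(2,2)$ has $\boldsymbol{g}$-vector $\lambda=(\lambda_0,\lambda_1)\in\mathbb{Z}^2$ if it can be written as $x_0^{\lambda_0}x_1^{\lambda_1}\sum_{\alpha_0,\alpha_1\ge0}\rho_{\alpha_0,\alpha_1}x_0^{-2\alpha_0}x_1^{2\alpha_1}$ with $\rho_{0,0}=1$; it is pointed if an analogous expression holds after expanding in every cluster $\{x_k,x_{k+1}\}$, and a basis is pointed if all its elements are pointed. Cluster monomials are the elements $x_k^{\alpha_k}x_{k+1}^{\alpha_{k+1}}$ with $\alpha_k,\alpha_{k+1}\ge0$.
   Formalization: A pointed basis is additionally required to have distinct g-vectors for distinct elements in every cluster; without this the claim fails, e.g. replacing the cluster monomial 1 by z²+1, z=(x_0²+x_1²+1)/(x_0x_1), in the basis with the z^n gives another basis of pointed elements. *)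

theory Defs
  imports "HOL-Computational_Algebra.Computational_Algebra"
begin

section \<open>The ambient field \<open>K(x\<^sub>0, x\<^sub>1)\<close> as a vector space over \<open>K\<close>\<close>

text \<open>
  \<open>'k poly poly\<close> is \<open>K[x\<^sub>0][x\<^sub>1]\<close>: the inner polynomial variable is \<open>x\<^sub>0\<close>, the outer one is \<open>x\<^sub>1\<close>.
\<close>

type_synonym 'k ratfun2 = "'k poly poly fract"

definition const :: "'k::field \<Rightarrow> 'k ratfun2" where
  "const c = to_fract [:[:c:]:]"

definition kscale :: "'k::field \<Rightarrow> 'k ratfun2 \<Rightarrow> 'k ratfun2" where
  "kscale c f = const c * f"

lemma const_add: "const (c + d) = const c + const d"
  by (simp add: const_def flip: to_fract_add)

lemma const_mult: "const (c * d) = const c * const d"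
  by (simp add: const_def flip: to_fract_mult)

lemma const_1 [simp]: "const 1 = 1"
  by (simp add: const_def flip: one_pCons)

global_interpretation ratfun2: vector_space kscale
  by unfold_locales (simp_all add: kscale_def const_add const_mult algebra_simps)


section \<open>The cluster algebra \<open>A(2,2)\<close>\<close>

fun exchange_seq :: "'f::field \<Rightarrow> 'f \<Rightarrow> nat \<Rightarrow> 'f" where
  "exchange_seq u v 0 = u"
| "exchange_seq u v (Suc 0) = v"
| "exchange_seq u v (Suc (Suc n)) = ((exchange_seq u v (Suc n))\<^sup>2 + 1) / exchange_seq u v n"

text \<open>
  The exchange relation is invariant under reversing the order of the cluster variables, so
  \<open>x\<^sub>1, x\<^sub>0, x\<^sub>-\<^sub>1, \<dots>\<close> is the sequence generated from \<open>x\<^sub>1, x\<^sub>0\<close>.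
  See \<open>cluster_var_nonzero\<close> and \<open>cluster_var_exchange\<close> below.
\<close>

definition cluster_var :: "int \<Rightarrow> 'k::field ratfun2" where
  "cluster_var m =
     (let X0 = to_fract [:[:0, 1:]:]; X1 = to_fract [:0, 1:]
      in if m \<ge> 0 then exchange_seq X0 X1 (nat m) else exchange_seq X1 X0 (nat (1 - m)))"

inductive_set cluster_algebra :: "'k::field ratfun2 set" where
  const: "const c \<in> cluster_algebra"
| var: "cluster_var m \<in> cluster_algebra"
| add: "f \<in> cluster_algebra \<Longrightarrow> g \<in> cluster_algebra \<Longrightarrow> f + g \<in> cluster_algebra"
| mult: "f \<in> cluster_algebra \<Longrightarrow> g \<in> cluster_algebra \<Longrightarrow> f * g \<in> cluster_algebra"

definition linear_basis :: "'k::field ratfun2 set \<Rightarrow> bool" where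
  "linear_basis B \<longleftrightarrow> ratfun2.independent B \<and> ratfun2.span B = cluster_algebra"

definition cluster_monomials :: "'k::field ratfun2 set" where
  "cluster_monomials = {cluster_var k ^ p * cluster_var (k + 1) ^ q | k p q. True}"


section \<open>Pointed elements and pointed bases\<close>

text \<open>
  \<open>has_gvector k (g\<^sub>0, g\<^sub>1) z\<close>: the g-vector of \<open>z\<close> with respect to the cluster
  \<open>{x\<^sub>k, x\<^sub>k\<^sub>+\<^sub>1}\<close>.  The exchange matrix changes sign under mutation and the two variables of the
  cluster swap their roles, so the expression for \<open>{x\<^sub>0, x\<^sub>1}\<close> is simply shifted by \<open>k\<close>.
  By the Laurent phenomenon only finite sums are needed.
\<close>

definition has_gvector :: "int \<Rightarrow> int \<times> int \<Rightarrow> 'k::field ratfun2 \<Rightarrow> bool" where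
  "has_gvector k g z \<longleftrightarrow>
     (\<exists>\<rho> :: nat \<times> nat \<Rightarrow> 'k.
        finite {\<alpha>. \<rho> \<alpha> \<noteq> 0} \<and> \<rho> (0, 0) = 1 \<and>
        z = cluster_var k powi fst g * cluster_var (k + 1) powi snd g *
            (\<Sum>\<alpha> | \<rho> \<alpha> \<noteq> 0. const (\<rho> \<alpha>) * cluster_var k powi (- 2 * int (fst \<alpha>))
                                     * cluster_var (k + 1) powi (2 * int (snd \<alpha>))))"

definition pointed :: "'k::field ratfun2 \<Rightarrow> bool" where
  "pointed z \<longleftrightarrow> z \<in> cluster_algebra \<and> (\<forall>k. \<exists>g. has_gvector k g z)"

text \<open>
  A pointed basis consists of pointed elements and is parametrized by g-vectors: in each cluster,
  no two of its elements share their g-vector.  Without the latter requirement there would be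
  further bases of pointed elements.  For instance, put \<open>z = (x\<^sub>0\<^sup>2 + x\<^sub>1\<^sup>2 + 1) / (x\<^sub>0 x\<^sub>1)\<close>; then in
  the basis formed by the cluster monomials and all \<open>z\<^sup>n\<close> with \<open>n \<ge> 1\<close> one could replace
  the cluster monomial \<open>1\<close> by \<open>z\<^sup>2 + 1\<close>, which has the g-vectors of \<open>z\<^sup>2\<close>; or \<open>x\<^sub>0\<^sup>2\<close> by
  \<open>x\<^sub>-\<^sub>1 x\<^sub>1 = x\<^sub>0\<^sup>2 + 1\<close>, whose g-vector in the cluster \<open>{x\<^sub>-\<^sub>1, x\<^sub>0}\<close> is that of \<open>1\<close>.
\<close>

definition pointed_basis :: "'k::field ratfun2 set \<Rightarrow> bool" where
  "pointed_basis B \<longleftrightarrow>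
     linear_basis B \<and> (\<forall>z\<in>B. pointed z) \<and>
     (\<forall>k g. \<forall>z\<in>B. \<forall>w\<in>B. has_gvector k g z \<longrightarrow> has_gvector k g w \<longrightarrow> z = w)"


section \<open>The bases attached to points of tori\<close>

definition S_coeff :: "nat \<Rightarrow> (nat \<Rightarrow> 'k::field) \<Rightarrow> nat \<Rightarrow> 'k" where
  "S_coeff n a r =
     (\<Sum>(I, J) \<in> {(I, J). I \<subseteq> {1..n} \<and> J \<subseteq> {1..n} \<and> card I = r \<and> card J = r \<and> I \<inter> J = {}}.
        (\<Prod>i\<in>I. a i) / (\<Prod>j\<in>J. a j))"

text \<open>
  For \<open>2 * r > n\<close> the factor \<open>S_coeff n a r\<close> is an empty sum, so the truncated
  subtraction \<open>n - 2 * r\<close> is harmless.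
\<close>

definition x_imag :: "nat \<Rightarrow> (nat \<Rightarrow> 'k::field) \<Rightarrow> 'k ratfun2" where
  "x_imag n a =
     cluster_var 0 powi (- int n) * cluster_var 1 powi (- int n) *
     (\<Sum>l = 0..n. \<Sum>k = 0..l. \<Sum>r = 0..l.
        const (of_nat ((l - r) choose k) * of_nat ((n - 2 * r) choose (l - r)) * S_coeff n a r)
        * cluster_var 0 ^ (2 * (l - k)) * cluster_var 1 ^ (2 * (n - l)))"

definition torus_points :: "(nat \<Rightarrow> nat \<Rightarrow> 'k::field) set" where
  "torus_points = {a. \<forall>n\<ge>1. \<forall>i\<in>{1..n}. a n i \<noteq> 0}"

definition basis_at :: "(nat \<Rightarrow> nat \<Rightarrow> 'k::field) \<Rightarrow> 'k ratfun2 set" where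
  "basis_at a = cluster_monomials \<union> {x_imag n (a n) | n. n \<ge> 1}"


section \<open>The cluster variables satisfy the exchange relation\<close>

context
begin

text \<open>
  Rational functions \<open>p / q\<close> such that \<open>p\<close> and \<open>q\<close> take positive integer values at \<open>(1, 1)\<close>.
  They are closed under addition, multiplication and division.
\<close>

private definition ev :: "'k::field_char_0 poly poly \<Rightarrow> 'k" where
  "ev p = poly (poly p 1) 1"

private definition pos :: "'k::field_char_0 ratfun2 \<Rightarrow> bool" where
  "pos f \<longleftrightarrow> (\<exists>p q m n. f = to_fract p / to_fract q \<and>
                  ev p = of_nat m \<and> ev q = of_nat n \<and> m > 0 \<and> n > 0)"

private lemma pos_nonzero: "pos f \<Longrightarrow> f \<noteq> 0"
  unfolding pos_def by (auto simp: ev_def)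

private lemma pos_to_fract: "ev p = 1 \<Longrightarrow> pos (to_fract p)"
  unfolding pos_def
  by (rule exI[of _ p], rule exI[of _ 1], rule exI[of _ 1], rule exI[of _ 1]) (simp add: ev_def)

private lemma pos_add: assumes "pos f" "pos g" shows "pos (f + g)"
proof -
  obtain p q m n where f: "f = to_fract p / to_fract q" "ev p = of_nat m" "ev q = of_nat n"
    "m > 0" "n > 0" using assms(1) unfolding pos_def by blast
  obtain p' q' m' n' where g: "g = to_fract p' / to_fract q'" "ev p' = of_nat m'"
    "ev q' = of_nat n'" "m' > 0" "n' > 0" using assms(2) unfolding pos_def by blast
  have "q \<noteq> 0" "q' \<noteq> 0" using f g by (auto simp: ev_def)
  hence "f + g = to_fract (p * q' + p' * q) / to_fract (q * q')"
    unfolding f g by (simp add: divide_simps)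
  moreover have "ev (p * q' + p' * q) = of_nat (m * n' + m' * n)" "ev (q * q') = of_nat (n * n')"
    using f g by (simp_all add: ev_def)
  moreover have "m * n' + m' * n > 0" "n * n' > 0" using f g by auto
  ultimately show ?thesis unfolding pos_def by blast
qed

private lemma pos_mult: assumes "pos f" "pos g" shows "pos (f * g)"
proof -
  obtain p q m n where f: "f = to_fract p / to_fract q" "ev p = of_nat m" "ev q = of_nat n"
    "m > 0" "n > 0" using assms(1) unfolding pos_def by blast
  obtain p' q' m' n' where g: "g = to_fract p' / to_fract q'" "ev p' = of_nat m'"
    "ev q' = of_nat n'" "m' > 0" "n' > 0" using assms(2) unfolding pos_def by blast
  have "f * g = to_fract (p * p') / to_fract (q * q')"
    unfolding f g by simp
  moreover have "ev (p * p') = of_nat (m * m')" "ev (q * q') = of_nat (n * n')"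
    using f g by (simp_all add: ev_def)
  moreover have "m * m' > 0" "n * n' > 0" using f g by auto
  ultimately show ?thesis unfolding pos_def by blast
qed

private lemma pos_inverse: assumes "pos f" shows "pos (inverse f)"
proof -
  obtain p q m n where f: "f = to_fract p / to_fract q" "ev p = of_nat m" "ev q = of_nat n"
    "m > 0" "n > 0" using assms(1) unfolding pos_def by blast
  have "inverse f = to_fract q / to_fract p"
    unfolding f by simp
  thus ?thesis using f(2-) unfolding pos_def by blast
qed

private lemma pos_one: "pos 1"
  using pos_to_fract[of 1] by (simp add: ev_def)

private lemma pos_exchange_seq: "pos u \<Longrightarrow> pos v \<Longrightarrow> pos (exchange_seq u v n)"
  by (induction u v n rule: exchange_seq.induct)
     (auto simp: power2_eq_square divide_inverse intro: pos_add pos_mult pos_inverse pos_one)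

lemma cluster_var_nonzero: "cluster_var m \<noteq> (0 :: 'k::field_char_0 ratfun2)"
  unfolding cluster_var_def Let_def
  by (auto intro!: pos_nonzero pos_exchange_seq pos_to_fract simp: ev_def)

lemma cluster_var_exchange:
  "cluster_var (m - 1) * cluster_var (m + 1) = (cluster_var m :: 'k::field_char_0 ratfun2)\<^sup>2 + 1"
proof -
  define X0 X1 :: "'k ratfun2" where "X0 = to_fract [:[:0, 1:]:]" and "X1 = to_fract [:0, 1:]"
  have fwd: "cluster_var j = exchange_seq X0 X1 (nat j)" if "j \<ge> 0" for j
    using that by (simp add: cluster_var_def X0_def X1_def)
  have bwd: "cluster_var j = exchange_seq X1 X0 (nat (1 - j))" if "j \<le> 1" for j
  proof -
    have "j < 0 \<or> j = 0 \<or> j = 1" using that by auto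
    thus ?thesis by (auto simp: cluster_var_def X0_def X1_def)
  qed
  have nz: "cluster_var (m - 1) \<noteq> (0 :: 'k ratfun2)" "cluster_var (m + 1) \<noteq> (0 :: 'k ratfun2)"
    by (rule cluster_var_nonzero)+
  show ?thesis
  proof (cases "m \<ge> 1")
    case True
    define n where "n = nat (m - 1)"
    have "nat (m - 1) = n" "nat m = Suc n" "nat (m + 1) = Suc (Suc n)"
      using True by (auto simp: n_def)
    thus ?thesis using True nz by (simp add: fwd)
  next
    case False
    define n where "n = nat (- m)"
    have "nat (1 - (m + 1)) = n" "nat (1 - m) = Suc n" "nat (1 - (m - 1)) = Suc (Suc n)"
      using False by (auto simp: n_def)
    thus ?thesis using False nz by (simp add: bwd)
  qed
qed

end

end

theory Submission
  imports Defs "HOL-Library.Product_Plus"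
begin

text \<open>
  Let \<open>z = (x\<^sub>0\<^sup>2 + x\<^sub>1\<^sup>2 + 1) / (x\<^sub>0 x\<^sub>1)\<close>, so that \<open>z x\<^sub>m = x\<^sub>m\<^sub>-\<^sub>1 + x\<^sub>m\<^sub>+\<^sub>1\<close> for all \<open>m\<close>.
  The elements \<open>x_imag n a\<close> are the polynomials \<open>\<Sum>\<^sub>r S\<^sub>r z\<^bsup>n-2r\<^esup>\<close>, and over an algebraically closed field
  the coefficients \<open>S\<^sub>r\<close>, \<open>1 \<le> r \<le> n/2\<close>, take arbitrary values.  So the claim is that
  the pointed bases are the sets formed by the cluster monomials and, for each \<open>n \<ge> 1\<close>, a monic
  polynomial of degree \<open>n\<close> in \<open>z\<close> having the parity of \<open>n\<close>.

  These sets span because \<open>x\<^sub>m x\<^sub>m\<^sub>+\<^sub>n - x\<^sub>m\<^sub>+\<^sub>1 x\<^sub>m\<^sub>+\<^sub>n\<^sub>-\<^sub>1\<close> is a polynomial in \<open>z\<close>, which allows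
  to straighten products of cluster variables.  For independence, order the exponents of each
  cluster lexicographically; then the g-vector of a pointed element is its leading exponent,
  and in each cluster distinct elements of the set have distinct g-vectors.

  Conversely, let \<open>B\<close> be a pointed basis and let \<open>p\<^sub>k(f)\<close> be the largest exponent of \<open>x\<^sub>k\<close> in the
  expansion of \<open>f\<close> in the cluster \<open>{x\<^sub>k, x\<^sub>k\<^sub>+\<^sub>1}\<close>.  As g-vectors are distinct, leading terms cannot
  cancel, so every element \<open>r\<close> occurring when \<open>f\<close> is expanded in a pointed basis satisfies
  \<open>p\<^sub>k(r) \<le> p\<^sub>k(f)\<close> for all \<open>k\<close>.  A cluster monomial is, up to scalars, the only element of the
  algebra dominated by itself in this sense, hence it lies in \<open>B\<close>; the elements dominated by
  \<open>z\<^sup>n\<close> are the polynomials of degree at most \<open>n\<close> in \<open>z\<close>, so \<open>B\<close> contains one of degree \<open>n\<close>.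
\<close>

section \<open>Spans in \<open>K(x\<^sub>0, x\<^sub>1)\<close>\<close>

lemma kscale_mult_left: "kscale c f * g = kscale c (f * g)"
  by (simp add: kscale_def)

lemma kscale_mult_right: "f * kscale c g = kscale c (f * g)"
  by (simp add: kscale_def)

lemma const_0 [simp]: "const 0 = 0"
  by (simp add: const_def)

lemma kscale_one: "kscale c 1 = const c"
  by (simp add: kscale_def)

text \<open>By bilinearity only products of generators have to be examined.\<close>

lemma span_mult:
  assumes "f \<in> ratfun2.span X" "g \<in> ratfun2.span Y"
    and XY: "\<And>x y. x \<in> X \<Longrightarrow> y \<in> Y \<Longrightarrow> x * y \<in> ratfun2.span Z"
  shows "f * g \<in> ratfun2.span Z"
  using assms(1)
proof (induction rule: ratfun2.span_induct_alt)
  case base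
  show ?case by (simp add: ratfun2.span_zero)
next
  case (step c x h)
  have "x * g \<in> ratfun2.span Z"
    using assms(2)
  proof (induction rule: ratfun2.span_induct_alt)
    case base
    show ?case by (simp add: ratfun2.span_zero)
  next
    case (step d y h')
    then show ?case
      using XY[OF \<open>x \<in> X\<close>, of y]
      by (simp add: distrib_left kscale_mult_right ratfun2.span_add ratfun2.span_scale)
  qed
  then show ?case
    using step by (simp add: distrib_right kscale_mult_left ratfun2.span_add ratfun2.span_scale)
qed

text \<open>The coefficients are indexed by \<open>I\<close> although \<open>m\<close> need not be
  injective: one preimage is chosen for each vector that occurs.\<close>

lemma span_image_obtains:
  assumes "f \<in> ratfun2.span (m ` I)"
  obtains \<rho> where "finite {i. \<rho> i \<noteq> 0}" "{i. \<rho> i \<noteq> 0} \<subseteq> I"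
    "f = (\<Sum>i | \<rho> i \<noteq> 0. kscale (\<rho> i) (m i))"
proof -
  obtain t r where t: "finite t" "t \<subseteq> m ` I" "f = (\<Sum>a\<in>t. kscale (r a) a)"
    using assms unfolding ratfun2.span_explicit by blast
  define s where "s = inv_into I m ` t"
  define \<rho> where "\<rho> i = (if i \<in> s then r (m i) else 0)" for i
  have s: "finite s" "s \<subseteq> I"
    using t by (auto simp: s_def inv_into_into)
  have m_inv: "m (inv_into I m a) = a" if "a \<in> t" for a
    using t(2) that by (metis f_inv_into_f subsetD)
  have "inj_on m s"
    using m_inv by (auto simp: s_def intro!: inj_onI)
  moreover have "m ` s = t"
    using m_inv by (force simp: s_def)
  ultimately have "f = (\<Sum>i\<in>s. kscale (r (m i)) (m i))"
    unfolding t(3) by (metis (no_types, lifting) sum.reindex_cong)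
  also have "\<dots> = (\<Sum>i\<in>s. kscale (\<rho> i) (m i))"
    by (simp add: \<rho>_def)
  also have "\<dots> = (\<Sum>i | \<rho> i \<noteq> 0. kscale (\<rho> i) (m i))"
    by (rule sum.mono_neutral_right) (use s in \<open>auto simp: \<rho>_def\<close>)
  finally have "f = \<dots>" .
  moreover have "finite {i. \<rho> i \<noteq> 0}" "{i. \<rho> i \<noteq> 0} \<subseteq> I"
    using s by (auto simp: \<rho>_def split: if_splits intro: finite_subset[of _ s])
  ultimately show ?thesis using that by blast
qed

section \<open>Laurent monomials of a cluster\<close>

definition laurent_mon :: "int \<Rightarrow> int \<times> int \<Rightarrow> 'k::field_char_0 ratfun2" where
  "laurent_mon k g = cluster_var k powi fst g * cluster_var (k + 1) powi snd g"

text \<open>Exponents of the non-leading monomials in \<open>has_gvector\<close>; excluding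
  \<open>(0, 0)\<close> keeps \<open>g\<close> itself out.\<close>

definition cone :: "int \<times> int \<Rightarrow> (int \<times> int) set" where
  "cone g = {(fst g - 2 * int a, snd g + 2 * int b) | a b. (a, b) \<noteq> (0, 0)}"

text \<open>A total order refining the partial order of \<open>cone\<close>, so that finite sets of
  g-vectors have a largest element.\<close>

definition below :: "int \<times> int \<Rightarrow> (int \<times> int) set" where
  "below g = {h. fst h < fst g \<or> fst h = fst g \<and> snd h > snd g}"

lemma laurent_mon_mult: "laurent_mon k g * laurent_mon k h = laurent_mon k (g + h)"
  by (simp add: laurent_mon_def power_int_add cluster_var_nonzero)

lemma laurent_mon_zero [simp]: "laurent_mon k 0 = 1"
  by (simp add: laurent_mon_def)

lemma cone_subset_below: "cone g \<subseteq> below g"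
  by (auto simp: cone_def below_def)

text \<open>Splitting off the normalised coefficient at \<open>(0, 0)\<close> leaves an arbitrary
  combination over the cone, so that g-vectors can be handled by span arguments instead of
  coefficient families.\<close>

lemma has_gvector_iff:
  "has_gvector k g (f :: 'k::field_char_0 ratfun2) \<longleftrightarrow>
     f - laurent_mon k g \<in> ratfun2.span (laurent_mon k ` cone g)"
proof
  define m :: "nat \<times> nat \<Rightarrow> 'k ratfun2"
    where "m \<alpha> = laurent_mon k (- 2 * int (fst \<alpha>), 2 * int (snd \<alpha>))" for \<alpha>
  have m_eq: "kscale c (m \<alpha>) = const c * cluster_var k powi (- 2 * int (fst \<alpha>))
                                     * cluster_var (k + 1) powi (2 * int (snd \<alpha>))" for c \<alpha>
    by (simp add: m_def laurent_mon_def kscale_def mult.assoc)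
  have m0: "m (0, 0) = 1"
    by (simp add: m_def laurent_mon_def)
  have shift: "laurent_mon k g * m \<alpha> \<in> laurent_mon k ` cone g" if "\<alpha> \<noteq> (0, 0)" for \<alpha>
    using that
    by (cases \<alpha>) (auto simp: m_def laurent_mon_mult cone_def plus_prod_def intro!: imageI)
  {
    assume "has_gvector k g f"
    then obtain \<rho> where \<rho>: "finite {\<alpha>. \<rho> \<alpha> \<noteq> 0}" "\<rho> (0, 0) = 1"
      "f = laurent_mon k g * (\<Sum>\<alpha> | \<rho> \<alpha> \<noteq> 0. kscale (\<rho> \<alpha>) (m \<alpha>))"
      unfolding has_gvector_def m_eq laurent_mon_def by blast
    have "f = laurent_mon k g
        * (1 + (\<Sum>\<alpha>\<in>{\<alpha>. \<rho> \<alpha> \<noteq> 0} - {(0, 0)}. kscale (\<rho> \<alpha>) (m \<alpha>)))"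
      unfolding \<rho>(3) by (subst sum.remove[of _ "(0, 0)"]) (use \<rho> m0 in \<open>auto simp: kscale_def\<close>)
    then have "f - laurent_mon k g
        = (\<Sum>\<alpha>\<in>{\<alpha>. \<rho> \<alpha> \<noteq> 0} - {(0, 0)}. kscale (\<rho> \<alpha>) (laurent_mon k g * m \<alpha>))"
      by (simp add: algebra_simps sum_distrib_left kscale_mult_right)
    also have "\<dots> \<in> ratfun2.span (laurent_mon k ` cone g)"
      by (intro ratfun2.span_sum ratfun2.span_scale ratfun2.span_base shift) auto
    finally show "f - laurent_mon k g \<in> ratfun2.span (laurent_mon k ` cone g)" .
  }
  {
    assume "f - laurent_mon k g \<in> ratfun2.span (laurent_mon k ` cone g)"
    also have "laurent_mon k ` cone g \<subseteq> (\<lambda>\<alpha>. laurent_mon k g * m \<alpha>) ` (UNIV - {(0, 0)})"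
      by (force simp: m_def laurent_mon_mult cone_def plus_prod_def)
    then have "ratfun2.span (laurent_mon k ` cone g)
        \<subseteq> ratfun2.span ((\<lambda>\<alpha>. laurent_mon k g * m \<alpha>) ` (UNIV - {(0, 0)}))"
      by (rule ratfun2.span_mono)
    finally obtain \<rho> where \<rho>: "finite {\<alpha>. \<rho> \<alpha> \<noteq> 0}" "{\<alpha>. \<rho> \<alpha> \<noteq> 0} \<subseteq> UNIV - {(0, 0)}"
      "f - laurent_mon k g = (\<Sum>\<alpha> | \<rho> \<alpha> \<noteq> 0. kscale (\<rho> \<alpha>) (laurent_mon k g * m \<alpha>))"
      by (rule span_image_obtains)
    \<comment> \<open>\<open>\<rho>\<close> vanishes at \<open>(0, 0)\<close>, which leaves room for
      the leading coefficient.\<close>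
    define \<sigma> where "\<sigma> = \<rho>((0, 0) := 1)"
    have supp: "{\<alpha>. \<sigma> \<alpha> \<noteq> 0} = insert (0, 0) {\<alpha>. \<rho> \<alpha> \<noteq> 0}"
      by (auto simp: \<sigma>_def)
    have "f = laurent_mon k g * (1 + (\<Sum>\<alpha> | \<rho> \<alpha> \<noteq> 0. kscale (\<rho> \<alpha>) (m \<alpha>)))"
      using \<rho>(3) by (simp add: algebra_simps sum_distrib_left kscale_mult_right)
    also have "(\<Sum>\<alpha> | \<rho> \<alpha> \<noteq> 0. kscale (\<rho> \<alpha>) (m \<alpha>)) = (\<Sum>\<alpha> | \<rho> \<alpha> \<noteq> 0. kscale (\<sigma> \<alpha>) (m \<alpha>))"
      by (rule sum.cong) (use \<rho>(2) in \<open>auto simp: \<sigma>_def\<close>)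
    also have "1 + \<dots> = (\<Sum>\<alpha> | \<sigma> \<alpha> \<noteq> 0. kscale (\<sigma> \<alpha>) (m \<alpha>))"
      unfolding supp by (subst sum.insert) (use \<rho> m0 in \<open>auto simp: \<sigma>_def kscale_def\<close>)
    finally have "f = laurent_mon k g * \<dots>" .
    moreover have "finite {\<alpha>. \<sigma> \<alpha> \<noteq> 0}" "\<sigma> (0, 0) = 1"
      using \<rho>(1) supp by (auto simp: \<sigma>_def)
    ultimately show "has_gvector k g f"
      unfolding has_gvector_def m_eq[symmetric] laurent_mon_def by blast
  }
qed

lemma has_gvector_below:
  assumes "has_gvector k g (f :: 'k::field_char_0 ratfun2)"
  shows "f - laurent_mon k g \<in> ratfun2.span (laurent_mon k ` below g)"
  using assms ratfun2.span_mono[OF image_mono[OF cone_subset_below]]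
  unfolding has_gvector_iff by blast

lemma has_gvector_laurent_mon: "has_gvector k g (laurent_mon k g :: 'k::field_char_0 ratfun2)"
  by (simp add: has_gvector_iff ratfun2.span_zero)

lemma has_gvector_one: "has_gvector k 0 (1 :: 'k::field_char_0 ratfun2)"
  using has_gvector_laurent_mon[of k 0, where ?'k = 'k] by simp

text \<open>Each factor is its leading monomial plus a tail over its cone. Apart from the product of
  the two leading monomials, every term has its exponent in \<open>cone (g + h)\<close>, since cone
  steps add up.\<close>

lemma has_gvector_mult:
  fixes f f' :: "'k::field_char_0 ratfun2"
  assumes "has_gvector k g f" "has_gvector k h f'"
  shows "has_gvector k (g + h) (f * f')"
proof -
  let ?S = "ratfun2.span (laurent_mon k ` cone (g + h))"
  define d d' where "d = f - laurent_mon k g" and "d' = f' - laurent_mon k h"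
  have d: "d \<in> ratfun2.span (laurent_mon k ` cone g)"
    and d': "d' \<in> ratfun2.span (laurent_mon k ` cone h)"
    using assms by (simp_all add: d_def d'_def has_gvector_iff)
  have add_gen: "x + y \<in> cone (g + h)"
    if xy: "x \<in> insert g (cone g)" "y \<in> insert h (cone h)" "(x, y) \<noteq> (g, h)" for x y
  proof -
    obtain a b where x: "x = (fst g - 2 * int a, snd g + 2 * int b)" "x \<noteq> g \<longrightarrow> (a, b) \<noteq> (0, 0)"
      using xy(1) by (cases "x = g") (force simp: cone_def intro: that[of 0 0])+
    obtain a' b' where y: "y = (fst h - 2 * int a', snd h + 2 * int b')"
      "y \<noteq> h \<longrightarrow> (a', b') \<noteq> (0, 0)"
      using xy(2) by (cases "y = h") (force simp: cone_def intro: that[of 0 0])+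
    have "x + y = (fst (g + h) - 2 * int (a + a'), snd (g + h) + 2 * int (b + b'))"
      by (simp add: x(1) y(1))
    moreover have "(a + a', b + b') \<noteq> (0, 0)"
      using xy(3) x(2) y(2) by auto
    ultimately show ?thesis unfolding cone_def by blast
  qed
  have irrefl: "g \<notin> cone g" for g
    by (cases g) (auto simp: cone_def)
  have mon: "laurent_mon k x * laurent_mon k y \<in> ?S"
    if "x \<in> insert g (cone g)" "y \<in> insert h (cone h)" "x \<in> cone g \<or> y \<in> cone h" for x y
  proof -
    have "(x, y) \<noteq> (g, h)"
      using that(3) irrefl[of g] irrefl[of h] by auto
    then show ?thesis
      unfolding laurent_mon_mult by (intro ratfun2.span_base imageI add_gen[OF that(1,2)])
  qed
  have "d * d' \<in> ?S"
    by (rule span_mult[OF d d']) (auto intro: mon)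
  moreover have "laurent_mon k g * d' \<in> ?S"
    by (rule span_mult[OF ratfun2.span_base[OF singletonI] d']) (auto intro: mon)
  moreover have "d * laurent_mon k h \<in> ?S"
    by (rule span_mult[OF d ratfun2.span_base[OF singletonI]]) (auto intro: mon)
  moreover have "f * f' - laurent_mon k (g + h)
      = d * d' + laurent_mon k g * d' + d * laurent_mon k h"
    by (simp add: d_def d'_def algebra_simps flip: laurent_mon_mult)
  ultimately show ?thesis
    unfolding has_gvector_iff by (metis ratfun2.span_add)
qed

lemma has_gvector_power:
  "has_gvector k (a, b) (f :: 'k::field_char_0 ratfun2) \<Longrightarrow>
     has_gvector k (int n * a, int n * b) (f ^ n)"
proof (induction n)
  case 0
  then show ?case using has_gvector_one by (simp add: zero_prod_def)
next
  case (Suc n)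
  then show ?case
    using has_gvector_mult[of k "(a, b)" f "(int n * a, int n * b)" "f ^ n"]
    by (simp add: algebra_simps)
qed

text \<open>Lying in a cone is transitive, so the leading monomial of \<open>f'\<close> and its tail
  both join the tail of \<open>f\<close>.\<close>

lemma has_gvector_add_scale:
  fixes f f' :: "'k::field_char_0 ratfun2"
  assumes "has_gvector k g f" "has_gvector k h f'" "h \<in> cone g"
  shows "has_gvector k g (f + kscale c f')"
proof -
  let ?S = "ratfun2.span (laurent_mon k ` cone g)"
  have "cone h \<subseteq> cone g"
  proof
    fix x assume "x \<in> cone h"
    then obtain a b where x: "x = (fst h - 2 * int a, snd h + 2 * int b)"
      by (auto simp: cone_def)
    obtain a' b' where h: "h = (fst g - 2 * int a', snd g + 2 * int b')" "(a', b') \<noteq> (0, 0)"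
      using assms(3) by (auto simp: cone_def)
    have "x = (fst g - 2 * int (a + a'), snd g + 2 * int (b + b'))"
      by (simp add: x h)
    moreover have "(a + a', b + b') \<noteq> (0, 0)"
      using h by auto
    ultimately show "x \<in> cone g" unfolding cone_def by blast
  qed
  then have "f' - laurent_mon k h \<in> ?S"
    using assms(2) ratfun2.span_mono[of "laurent_mon k ` cone h" "laurent_mon k ` cone g"]
    unfolding has_gvector_iff by blast
  moreover have "laurent_mon k h \<in> ?S"
    using assms(3) by (intro ratfun2.span_base imageI)
  ultimately have "f' \<in> ?S"
    by (metis ratfun2.span_add diff_add_cancel)
  then have "(f - laurent_mon k g) + kscale c f' \<in> ?S"
    using assms(1) by (intro ratfun2.span_add ratfun2.span_scale) (simp_all add: has_gvector_iff)
  then show ?thesis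
    by (simp add: has_gvector_iff algebra_simps)
qed

section \<open>Leading exponents\<close>

lemma below_trans: "h \<in> below g \<Longrightarrow> i \<in> below h \<Longrightarrow> i \<in> below g"
  by (auto simp: below_def)

lemma below_irrefl: "g \<notin> below g"
  by (auto simp: below_def)

lemma below_linear: "g = h \<or> g \<in> below h \<or> h \<in> below g"
  by (cases g; cases h) (auto simp: below_def)

lemma below_maximal:
  assumes "finite G" "G \<noteq> {}"
  obtains g where "g \<in> G" "G \<subseteq> insert g (below g)"
  using assms
proof (induction arbitrary: thesis rule: finite_ne_induct)
  case (singleton g)
  then show ?case by simp
next
  case (insert h G)
  obtain g where "g \<in> G" "G \<subseteq> insert g (below g)"
    using insert.IH by blast
  then show ?case
    using below_linear[of g h] below_trans insert.prems[of g] insert.prems[of h] by blast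
qed

section \<open>Leading terms, assuming that the Laurent monomials of the cluster are
  independent\<close>

context
  fixes k :: int
  assumes indep: "\<forall>g D. (laurent_mon k g :: 'k::field_char_0 ratfun2)
      \<in> ratfun2.span (laurent_mon k ` D) \<longrightarrow> g \<in> D"
begin

text \<open>Independence is assumed in this context because its lemmas are first applied to
  \<open>{x\<^sub>0, x\<^sub>1}\<close> and then serve to carry independence over to the other
  clusters. Of two different g-vectors, the monomial of the larger one would lie in the span of
  strictly smaller monomials.\<close>

lemma has_gvector_unique_if_indep:
  fixes f :: "'k ratfun2"
  assumes "has_gvector k g f" "has_gvector k h f"
  shows "g = h"
proof -
  have False if "has_gvector k g f" "has_gvector k h f" "h \<in> below g" for g h
  proof -
    let ?S = "ratfun2.span (laurent_mon k ` below g) :: 'k ratfun2 set"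
    have "below h \<subseteq> below g"
      using that(3) below_trans by blast
    then have "f - laurent_mon k h \<in> ?S"
      using has_gvector_below[OF that(2)]
        ratfun2.span_mono[of "laurent_mon k ` below h" "laurent_mon k ` below g"] by blast
    moreover have "laurent_mon k h \<in> ?S"
      using that(3) by (intro ratfun2.span_base imageI)
    ultimately have "f \<in> ?S"
      by (metis ratfun2.span_add diff_add_cancel)
    then have "f - (f - laurent_mon k g) \<in> ?S"
      using has_gvector_below[OF that(1)] by (rule ratfun2.span_diff)
    then have "g \<in> below g"
      by (intro indep[rule_format]) simp
    then show False
      using below_irrefl by blast
  qed
  then show ?thesis
    using assms below_linear by blast
qed

text \<open>The largest g-vector occurring in a linear combination cannot cancel.\<close>

lemma combination_gvectors_if_indep:
  fixes T :: "'k ratfun2 set"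
  assumes "finite T" and gv: "\<And>s. s \<in> T \<Longrightarrow> has_gvector k (\<gamma> s) s" and inj: "inj_on \<gamma> T"
    and comb: "(\<Sum>s\<in>T. kscale (c s) s) \<in> ratfun2.span (laurent_mon k ` D)"
    and down: "\<And>g h. g \<in> D \<Longrightarrow> h \<in> below g \<Longrightarrow> h \<in> D"
    and s: "s \<in> T" "c s \<noteq> 0"
  shows "\<gamma> s \<in> D"
proof -
  define T' where "T' = {s \<in> T. c s \<noteq> 0}"
  have T': "finite T'" "s \<in> T'"
    using assms by (auto simp: T'_def)
  then obtain g where g: "g \<in> \<gamma> ` T'" "\<gamma> ` T' \<subseteq> insert g (below g)"
    using below_maximal[of "\<gamma> ` T'"] by blast
  then obtain m where m: "m \<in> T'" "\<gamma> m = g" by blast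
  \<comment> \<open>Adding \<open>below g\<close> to \<open>D\<close> absorbs all terms other than
    \<open>m\<close> as well as the tail of \<open>m\<close>, while \<open>g\<close> itself can only
    come from \<open>D\<close>.\<close>
  let ?S = "ratfun2.span (laurent_mon k ` (D \<union> below g)) :: 'k ratfun2 set"
  have below_S: "ratfun2.span (laurent_mon k ` below g) \<subseteq> ?S"
    by (intro ratfun2.span_mono image_mono) auto
  have other: "t \<in> ?S" if "t \<in> T' - {m}" for t
  proof -
    have "\<gamma> t \<noteq> g"
      using that m inj by (auto simp: T'_def inj_on_def)
    then have t: "\<gamma> t \<in> below g"
      using g(2) that by blast
    then have "below (\<gamma> t) \<subseteq> below g"
      using below_trans by blast
    then have "t - laurent_mon k (\<gamma> t) \<in> ?S"
      using has_gvector_below[OF gv, of t] that below_S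
        ratfun2.span_mono[of "laurent_mon k ` below (\<gamma> t)" "laurent_mon k ` below g"]
      by (auto simp: T'_def)
    moreover have "laurent_mon k (\<gamma> t) \<in> ?S"
      using t by (intro ratfun2.span_base imageI) auto
    ultimately show ?thesis
      by (metis ratfun2.span_add diff_add_cancel)
  qed
  have "(\<Sum>s\<in>T. kscale (c s) s) = (\<Sum>s\<in>T'. kscale (c s) s)"
    using assms(1) by (intro sum.mono_neutral_right) (auto simp: T'_def)
  also have "\<dots> = kscale (c m) m + (\<Sum>s\<in>T' - {m}. kscale (c s) s)"
    using T'(1) m(1) by (rule sum.remove)
  finally have "kscale (c m) m = (\<Sum>s\<in>T. kscale (c s) s) - (\<Sum>s\<in>T' - {m}. kscale (c s) s)"
    by simp
  also have "\<dots> \<in> ?S"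
  proof (rule ratfun2.span_diff)
    show "(\<Sum>s\<in>T. kscale (c s) s) \<in> ?S"
      using comb ratfun2.span_mono[OF image_mono[OF Un_upper1]] by blast
    show "(\<Sum>s\<in>T' - {m}. kscale (c s) s) \<in> ?S"
      by (rule ratfun2.span_sum, rule ratfun2.span_scale, rule other)
  qed
  finally have "kscale (inverse (c m)) (kscale (c m) m) \<in> ?S"
    by (rule ratfun2.span_scale)
  then have "m \<in> ?S"
    using m by (simp add: T'_def)
  moreover have "m - laurent_mon k g \<in> ?S"
    using has_gvector_below[OF gv, of m] m below_S by (auto simp: T'_def)
  ultimately have "m - (m - laurent_mon k g) \<in> ?S"
    by (rule ratfun2.span_diff)
  then have "g \<in> D \<union> below g"
    by (intro indep[rule_format]) simp
  then have "g \<in> D"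
    using below_irrefl by blast
  moreover have "\<gamma> s \<in> insert g (below g)"
    using g(2) T'(2) by blast
  ultimately show ?thesis
    using down by blast
qed

text \<open>The case of a vanishing combination: there \<open>D\<close> is empty, so no g-vector can
  occur.\<close>

lemma independent_if_gvectors_if_indep:
  fixes S :: "'k ratfun2 set"
  assumes gv: "\<And>s. s \<in> S \<Longrightarrow> \<exists>g. has_gvector k g s"
    and inj: "\<And>s s' g. s \<in> S \<Longrightarrow> s' \<in> S \<Longrightarrow> has_gvector k g s \<Longrightarrow> has_gvector k g s' \<Longrightarrow> s = s'"
  shows "ratfun2.independent S"
proof -
  obtain \<gamma> where \<gamma>: "\<And>s. s \<in> S \<Longrightarrow> has_gvector k (\<gamma> s) s"
    using gv by metis
  then have "inj_on \<gamma> S"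
    using inj by (metis inj_onI)
  have "c v = 0" if "finite T" "T \<subseteq> S" "(\<Sum>v\<in>T. kscale (c v) v) = 0" "v \<in> T" for T c v
  proof (rule ccontr)
    assume "c v \<noteq> 0"
    then have "\<gamma> v \<in> {}"
      using that \<gamma> inj_on_subset[OF \<open>inj_on \<gamma> S\<close>]
      by (intro combination_gvectors_if_indep[of T \<gamma> c]) (auto simp: ratfun2.span_zero)
    then show False by simp
  qed
  then show ?thesis
    unfolding ratfun2.dependent_explicit by blast
qed

end

text \<open>Only finitely many exponents occur, so multiplication by a high power of
  \<open>x\<^sub>k x\<^sub>k\<^sub>+\<^sub>1\<close> makes all of them nonnegative.\<close>

lemma indep_if_nonneg_indep:
  fixes g :: "int \<times> int"
  assumes *: "\<And>g D. \<lbrakk>fst g \<ge> 0; snd g \<ge> 0; \<And>h. h \<in> D \<Longrightarrow> fst h \<ge> 0 \<and> snd h \<ge> 0;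
      (laurent_mon k g :: 'k::field_char_0 ratfun2) \<in> ratfun2.span (laurent_mon k ` D)\<rbrakk> \<Longrightarrow> g \<in> D"
    and g: "(laurent_mon k g :: 'k ratfun2) \<in> ratfun2.span (laurent_mon k ` D)"
  shows "g \<in> D"
proof -
  obtain \<rho> where \<rho>: "finite {h. \<rho> h \<noteq> 0}" "{h. \<rho> h \<noteq> 0} \<subseteq> D"
    "(laurent_mon k g :: 'k ratfun2) = (\<Sum>h | \<rho> h \<noteq> 0. kscale (\<rho> h) (laurent_mon k h))"
    using span_image_obtains[OF g] by blast
  define F where "F = {h. \<rho> h \<noteq> 0}"
  define N where "N = (\<Sum>h\<in>insert g F. \<bar>fst h\<bar> + \<bar>snd h\<bar>)"
  have N: "fst h + N \<ge> 0 \<and> snd h + N \<ge> 0" if "h \<in> insert g F" for h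
  proof -
    have "\<bar>fst h\<bar> + \<bar>snd h\<bar> \<le> N"
      unfolding N_def using that \<rho>(1) by (intro member_le_sum) (auto simp: F_def)
    then show ?thesis by linarith
  qed
  have "laurent_mon k (g + (N, N))
      = (\<Sum>h\<in>F. kscale (\<rho> h) (laurent_mon k (h + (N, N)) :: 'k ratfun2))"
    using \<rho>(3) by (simp add: F_def kscale_mult_left sum_distrib_right flip: laurent_mon_mult)
  also have "\<dots> \<in> ratfun2.span (laurent_mon k ` (\<lambda>h. h + (N, N)) ` F)"
    by (intro ratfun2.span_sum ratfun2.span_scale ratfun2.span_base) auto
  finally have "g + (N, N) \<in> (\<lambda>h. h + (N, N)) ` F"
  proof (rule *[rotated 3])
    show "fst (g + (N, N)) \<ge> 0" "snd (g + (N, N)) \<ge> 0"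
      using N[of g] by simp_all
    show "fst h \<ge> 0 \<and> snd h \<ge> 0" if "h \<in> (\<lambda>h. h + (N, N)) ` F" for h
      using that N[of "h - (N, N)"] by auto
  qed
  then have "g \<in> F"
    by (metis (no_types, lifting) add_right_imp_eq imageE)
  then show ?thesis
    using \<rho>(2) by (auto simp: F_def)
qed

section \<open>Linear independence of the Laurent monomials of
  \<open>{x\<^sub>0, x\<^sub>1}\<close>\<close>

lemma cluster_var_0: "cluster_var 0 = to_fract [:[:0, 1:]:]"
  and cluster_var_1: "cluster_var 1 = to_fract [:0, 1:]"
  by (simp_all add: cluster_var_def)

lemma to_fract_power: "to_fract (p ^ n) = to_fract p ^ n"
  by (induction n) auto

lemma to_fract_monom: "to_fract (monom (monom 1 a) b)
    = cluster_var 0 ^ a * (cluster_var 1 ^ b :: 'k::field ratfun2)"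
proof -
  have "monom (monom 1 a) b = [:[:0, 1 :: 'k:]:] ^ a * [:0, 1:] ^ b"
    by (simp add: monom_altdef poly_const_pow)
  then show ?thesis
    by (simp add: cluster_var_0 cluster_var_1 to_fract_power)
qed

lemma laurent_mon_nonneg:
  "fst g \<ge> 0 \<Longrightarrow> snd g \<ge> 0 \<Longrightarrow>
    laurent_mon k g = cluster_var k ^ nat (fst g) * cluster_var (k + 1) ^ nat (snd g)"
  by (simp add: laurent_mon_def power_int_def)

text \<open>With nonnegative exponents these are monomials of the polynomial ring. If
  \<open>g\<close> is outside \<open>D\<close>, every combination over \<open>D\<close> has
  coefficient 0 at \<open>g\<close>, whereas the monomial itself has coefficient 1 there.\<close>

lemma laurent_mon_indep_0:
  "\<forall>g D. (laurent_mon 0 g :: 'k::field_char_0 ratfun2) \<in> ratfun2.span (laurent_mon 0 ` D) \<longrightarrow> g \<in> D"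
proof (intro allI impI, erule indep_if_nonneg_indep[rotated])
  fix g D
  assume g: "fst g \<ge> 0" "snd g \<ge> 0" and D: "\<And>h. h \<in> D \<Longrightarrow> fst h \<ge> 0 \<and> snd h \<ge> 0"
    and span: "(laurent_mon 0 g :: 'k ratfun2) \<in> ratfun2.span (laurent_mon 0 ` D)"
  have mon: "laurent_mon 0 h = to_fract (monom (monom (1 :: 'k) (nat (fst h))) (nat (snd h)))"
    if "fst h \<ge> 0" "snd h \<ge> 0" for h
    using that by (simp add: to_fract_monom laurent_mon_nonneg)
  show "g \<in> D"
  proof (rule ccontr)
    assume "g \<notin> D"
    have "\<exists>P. f = to_fract P \<and> coeff (coeff P (nat (snd g))) (nat (fst g)) = 0"
      if "f \<in> ratfun2.span (laurent_mon 0 ` D)" for f :: "'k ratfun2"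
      using that
    proof (induction rule: ratfun2.span_induct_alt)
      case base
      show ?case by (intro exI[of _ 0]) simp
    next
      case (step c x y)
      then obtain P where P: "y = to_fract P" "coeff (coeff P (nat (snd g))) (nat (fst g)) = 0"
        by blast
      obtain h where h: "h \<in> D" "x = laurent_mon 0 h"
        using step by blast
      let ?Q = "monom (monom (1 :: 'k) (nat (fst h))) (nat (snd h))"
      have "h \<noteq> g" "fst h \<ge> 0" "snd h \<ge> 0"
        using h D \<open>g \<notin> D\<close> by auto
      then have "coeff (coeff ?Q (nat (snd g))) (nat (fst g)) = 0"
        using g by (auto simp: prod_eq_iff)
      then have "coeff (coeff ([:[:c:]:] * ?Q + P) (nat (snd g))) (nat (fst g)) = 0"
        using P by simp
      moreover have "kscale c x + y = to_fract ([:[:c:]:] * ?Q + P)"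
        unfolding to_fract_add to_fract_mult
        using h D P by (simp add: kscale_def const_def mon)
      ultimately show ?case by blast
    qed
    from this[OF span] mon[OF g]
    have "coeff (coeff (monom (monom (1 :: 'k) (nat (fst g))) (nat (snd g))) (nat (snd g))) (nat
        (fst g)) = 0"
      by auto
    then show False by simp
  qed
qed

section \<open>The g-vectors of the cluster variables\<close>

definition zed :: "'k::field_char_0 ratfun2" where
  "zed = (cluster_var 0 ^ 2 + cluster_var 1 ^ 2 + 1) / (cluster_var 0 * cluster_var 1)"

text \<open>
  The quotient \<open>(x\<^sub>m\<^sub>-\<^sub>1 + x\<^sub>m\<^sub>+\<^sub>1) / x\<^sub>m\<close> does not depend on \<open>m\<close>: by the exchange relation, both
  the quotient for \<open>m\<close> and the one for \<open>m + 1\<close> equal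
  \<open>(x\<^sub>m\<^sup>2 + x\<^sub>m\<^sub>+\<^sub>1\<^sup>2 + 1) / (x\<^sub>m x\<^sub>m\<^sub>+\<^sub>1)\<close>.
\<close>

lemma zed_times_cluster_var:
  "zed * cluster_var m = cluster_var (m - 1) + (cluster_var (m + 1) :: 'k::field_char_0 ratfun2)"
proof -
  define x :: "int \<Rightarrow> 'k ratfun2" where "x = cluster_var"
  have nz: "x j \<noteq> 0" for j
    by (simp add: x_def cluster_var_nonzero)
  define q where "q j = (x (j - 1) + x (j + 1)) / x j" for j
  have ex: "x (j - 1) * x (j + 1) = x j ^ 2 + 1" for j
    by (simp add: x_def cluster_var_exchange)
  have left: "q j * (x j * x (j + 1)) = x j ^ 2 + x (j + 1) ^ 2 + 1" for j
  proof -
    have "q j * (x j * x (j + 1)) = (x (j - 1) + x (j + 1)) * x (j + 1)"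
      using nz[of j] by (simp add: q_def)
    then show ?thesis
      using ex[of j] by (simp add: power2_eq_square distrib_right)
  qed
  have right: "q (j + 1) * (x j * x (j + 1)) = x j ^ 2 + x (j + 1) ^ 2 + 1" for j
  proof -
    have "q (j + 1) * (x j * x (j + 1)) = x j * (x j + x (j + 2))"
      using nz[of "j + 1"] by (simp add: q_def add.commute)
    then show ?thesis
      using ex[of "j + 1"] by (simp add: power2_eq_square distrib_left add.commute)
  qed
  have "q (j + 1) = q j" for j
    using left[of j] right[of j] nz[of j] nz[of "j + 1"]
    by (metis mult_right_cancel no_zero_divisors)
  then have "q j = q 0" for j
    by (induction j rule: int_induct[where k = 0]) (metis diff_add_cancel)+
  moreover have "q 0 = zed"
    using left[of 0] nz[of 0] nz[of 1] by (simp add: zed_def x_def field_simps)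
  ultimately have q: "zed = q m" by simp
  show ?thesis
    unfolding q x_def[symmetric] using nz[of m] by (simp add: q_def)
qed

lemma zed_eq:
  "zed * (cluster_var k * cluster_var (k + 1))
    = cluster_var k ^ 2 + cluster_var (k + 1) ^ 2 + (1 :: 'k::field_char_0 ratfun2)"
proof -
  have "zed * (cluster_var k * cluster_var (k + 1))
      = (cluster_var (k - 1) + cluster_var (k + 1)) * (cluster_var (k + 1) :: 'k ratfun2)"
    by (simp add: zed_times_cluster_var flip: mult.assoc)
  also have "\<dots> = cluster_var k ^ 2 + cluster_var (k + 1) ^ 2 + 1"
    using cluster_var_exchange[of k, where 'k = 'k]
    by (simp add: distrib_right power2_eq_square)
  finally show ?thesis .
qed

text \<open>By \<open>zed_eq\<close>, \<open>zed\<close> is a sum of three Laurent monomials of the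
  same shape in every cluster; two of their exponents arise from \<open>(1, -1)\<close> by cone
  steps.\<close>

lemma has_gvector_zed: "has_gvector k (1, -1) (zed :: 'k::field_char_0 ratfun2)"
proof -
  have nz: "cluster_var k \<noteq> (0 :: 'k ratfun2)" "cluster_var (k + 1) \<noteq> (0 :: 'k ratfun2)"
    by (rule cluster_var_nonzero)+
  then have "zed = (cluster_var k ^ 2 + cluster_var (k + 1) ^ 2 + (1 :: 'k ratfun2))
      / (cluster_var k * cluster_var (k + 1))"
    using zed_eq[of k, where 'k = 'k] by (simp add: field_simps)
  also have "\<dots> = laurent_mon k (1, -1) + laurent_mon k (-1, 1) + laurent_mon k (-1, -1)"
    using nz by (simp add: laurent_mon_def power_int_minus field_simps power2_eq_square)
  finally have eq: "zed - laurent_mon k (1, -1)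
      = laurent_mon k (-1, 1) + (laurent_mon k (-1, -1) :: 'k ratfun2)"
    by (simp add: algebra_simps)
  have "(-1, 1) \<in> cone (1, -1)"
    unfolding cone_def by (rule CollectI, rule exI[of _ 1], rule exI[of _ 1]) simp
  moreover have "(-1, -1) \<in> cone (1, -1)"
    unfolding cone_def by (rule CollectI, rule exI[of _ 1], rule exI[of _ 0]) simp
  ultimately show ?thesis
    unfolding has_gvector_iff eq by (intro ratfun2.span_add ratfun2.span_base imageI)
qed

lemma has_gvector_three_term:
  fixes f f' :: "'k::field_char_0 ratfun2"
  assumes "has_gvector k g f" "has_gvector k h f'" "h \<in> cone (g + (1, -1))"
  shows "has_gvector k (g + (1, -1)) (zed * f - f')"
  using has_gvector_add_scale[OF has_gvector_mult[OF assms(1) has_gvector_zed] assms(2,3), of "-1"]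
  by (simp add: mult.commute ratfun2.scale_minus_left)

text \<open>Convex with slopes -1 and 1 around its minimum -1 at -2, the index belonging to
  \<open>x\<^sub>k\<^sub>+\<^sub>2\<close>. One sequence gives both coordinates in
  \<open>gvec\<close>: the second is minus the first coordinate in the preceding cluster.\<close>

definition gexp :: "int \<Rightarrow> int" where
  "gexp i = \<bar>i + 2\<bar> - 1"

definition gvec :: "int \<Rightarrow> int \<Rightarrow> int \<times> int" where
  "gvec k j = (gexp (k - j), - gexp (k - j - 1))"

text \<open>Outside the indices \<open>k\<close> to \<open>k + 2\<close> the three-term recursion
  \<open>zed x_m = x_{m-1} + x_{m+1}\<close>, read upwards or downwards, adds \<open>(1, -1)\<close>
  at every step.\<close>

lemma has_gvector_cluster_var:
  "has_gvector k (gvec k j) (cluster_var j :: 'k::field_char_0 ratfun2)"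
proof -
  have var: "cluster_var (m + 1) = zed * cluster_var m - (cluster_var (m - 1) :: 'k ratfun2)" for m
    by (simp add: zed_times_cluster_var)
  have var': "cluster_var (m - 1) = zed * cluster_var m - (cluster_var (m + 1) :: 'k ratfun2)" for m
    by (simp add: zed_times_cluster_var)
  have cone_intro: "(a, b) \<in> cone (a', b')"
    if "a = a' - 2 * int s" "b = b' + 2 * int t" "(s, t) \<noteq> (0, 0)" for a b a' b' s t
    using that unfolding cone_def by auto
  have k0: "has_gvector k (1, 0) (cluster_var k :: 'k ratfun2)"
    using has_gvector_laurent_mon[of k "(1, 0)", where ?'k = 'k] by (simp add: laurent_mon_def)
  have k1: "has_gvector k (0, 1) (cluster_var (k + 1) :: 'k ratfun2)"
    using has_gvector_laurent_mon[of k "(0, 1)", where ?'k = 'k] by (simp add: laurent_mon_def)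
  \<comment> \<open>The recursion cannot give this g-vector: the leading term
    \<open>x\<^sub>k\<close> of \<open>zed x\<^sub>k\<^sub>+\<^sub>1\<close> is cancelled by the
    subtracted \<open>x\<^sub>k\<close>. The exchange relation is used instead.\<close>
  have k2: "has_gvector k (-1, 0) (cluster_var (k + 2) :: 'k ratfun2)"
  proof -
    have "cluster_var (k + 2) = (cluster_var (k + 1) ^ 2 + 1) / (cluster_var k :: 'k ratfun2)"
      using cluster_var_exchange[of "k + 1", where 'k = 'k] cluster_var_nonzero[of k, where 'k = 'k]
      by (simp add: field_simps)
    also have "\<dots> = laurent_mon k (-1, 0) + laurent_mon k (-1, 2)"
      by (simp add: laurent_mon_def power_int_minus add_divide_distrib divide_inverse algebra_simps)
    finally have "cluster_var (k + 2) - laurent_mon k (-1, 0)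
        = (laurent_mon k (-1, 2) :: 'k ratfun2)"
      by simp
    moreover have "(-1, 2) \<in> cone (-1, 0)"
      by (rule cone_intro[of _ _ 0 _ _ 1]) auto
    ultimately show ?thesis
      by (simp add: has_gvector_iff ratfun2.span_base)
  qed
  have up: "has_gvector k (gvec k (k + 2 + int n)) (cluster_var (k + 2 + int n) :: 'k ratfun2) \<and>
        has_gvector k (gvec k (k + 3 + int n)) (cluster_var (k + 3 + int n) :: 'k ratfun2)" for n
  proof (induction n)
    case 0
    have "has_gvector k ((-1, 0) + (1, -1)) (zed * cluster_var (k + 2) - (cluster_var (k
        + 1) :: 'k ratfun2))"
      by (rule has_gvector_three_term[OF k2 k1]) (simp add: cone_intro[of _ _ 0 _ _ 1])
    then show ?case
      using k2 var[of "k + 2"] by (simp add: gvec_def gexp_def add.commute)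
  next
    case (Suc n)
    have g: "gvec k (k + 3 + int n) + (1, -1) = gvec k (k + 4 + int n)"
      by (simp add: gvec_def gexp_def)
    have "gvec k (k + 2 + int n) \<in> cone (gvec k (k + 4 + int n))"
      unfolding gvec_def gexp_def by (rule cone_intro[of _ _ "if n = 0 then 1 else 1" _ _ 1]) auto
    then have "has_gvector k (gvec k (k + 4 + int n))
        (zed * cluster_var (k + 3 + int n) - cluster_var (k + 2 + int n) :: 'k ratfun2)"
      using has_gvector_three_term[of k "gvec k (k + 3 + int n)" "cluster_var (k + 3
          + int n) :: 'k ratfun2"] Suc
      unfolding g by blast
    also have "zed * cluster_var (k + 3 + int n) - cluster_var (k + 2 + int n)
        = (cluster_var (k + 4 + int n) :: 'k ratfun2)"
      using var[of "k + 3 + int n"] by (simp add: ac_simps)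
    finally have "has_gvector k (gvec k (k + 4 + int n)) (cluster_var (k + 4
        + int n) :: 'k ratfun2)" .
    moreover have shift: "k + 2 + int (Suc n) = k + 3 + int n" "k + 3 + int (Suc n) = k + 4 + int n"
      by simp_all
    ultimately show ?case
      using Suc unfolding shift by blast
  qed
  have down: "has_gvector k (gvec k (k - int n)) (cluster_var (k - int n) :: 'k ratfun2) \<and>
        has_gvector k (gvec k (k + 1 - int n)) (cluster_var (k + 1 - int n) :: 'k ratfun2)" for n
  proof (induction n)
    case 0
    show ?case
      using k0 k1 by (simp add: gvec_def gexp_def)
  next
    case (Suc n)
    have g: "gvec k (k - int n) + (1, -1) = gvec k (k - 1 - int n)"
      by (simp add: gvec_def gexp_def)
    have "gvec k (k + 1 - int n) \<in> cone (gvec k (k - 1 - int n))"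
      unfolding gvec_def gexp_def by (rule cone_intro[of _ _ 1 _ _ 1]) auto
    then have "has_gvector k (gvec k (k - 1 - int n))
        (zed * cluster_var (k - int n) - cluster_var (k + 1 - int n) :: 'k ratfun2)"
      using has_gvector_three_term[of k "gvec k (k - int n)" "cluster_var (k
          - int n) :: 'k ratfun2"] Suc
      unfolding g by blast
    also have "zed * cluster_var (k - int n) - cluster_var (k + 1 - int n)
        = (cluster_var (k - 1 - int n) :: 'k ratfun2)"
    proof -
      have "k - int n - 1 = k - 1 - int n" "k - int n + 1 = k + 1 - int n"
        by simp_all
      then show ?thesis
        using var'[of "k - int n"] by metis
    qed
    finally have "has_gvector k (gvec k (k - 1 - int n)) (cluster_var (k - 1
        - int n) :: 'k ratfun2)" .
    moreover have shift: "k - int (Suc n) = k - 1 - int n" "k + 1 - int (Suc n) = k - int n"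
      by simp_all
    ultimately show ?case
      using Suc unfolding shift by blast
  qed
  show ?thesis
    using up[of "nat (j - k - 2)"] down[of "nat (k - j)"] k1
    by (cases "j \<ge> k + 2"; cases "j = k + 1") (auto simp: gvec_def gexp_def)
qed

lemma has_gvector_cluster_monomial:
  "has_gvector k (int p * gexp (k - j) + int q * gexp (k - j - 1),
                  - (int p * gexp (k - j - 1) + int q * gexp (k - j - 2)))
     (cluster_var j ^ p * (cluster_var (j + 1) ^ q :: 'k::field_char_0 ratfun2))"
proof -
  have "has_gvector k (int p * gexp (k - j), int p * (- gexp (k - j - 1)))
      (cluster_var j ^ p :: 'k ratfun2)"
    by (rule has_gvector_power) (use has_gvector_cluster_var[of k j] in \<open>simp add: gvec_def\<close>)
  moreover have "has_gvector k (int q * gexp (k - j - 1), int q * (- gexp (k - j - 2)))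
      (cluster_var (j + 1) ^ q :: 'k ratfun2)"
    by (rule has_gvector_power) (use has_gvector_cluster_var[of k "j
        + 1"] in \<open>simp add: gvec_def algebra_simps\<close>)
  ultimately show ?thesis
    using has_gvector_mult by fastforce
qed

text \<open>
  The g-vectors of \<open>x\<^sub>k\<close> and \<open>x\<^sub>k\<^sub>+\<^sub>1\<close> in the cluster \<open>{x\<^sub>0, x\<^sub>1}\<close> have determinant 1.
\<close>

lemma gexp_determinant: "gexp i ^ 2 - gexp (i + 1) * gexp (i - 1) = 1"
proof -
  consider "i \<le> -3" | "i = -2" | "i \<ge> -1" by linarith
  then show ?thesis
    by cases (auto simp: gexp_def power2_eq_square algebra_simps)
qed

text \<open>Monomials of cluster \<open>k\<close> with nonnegative exponents are cluster monomials,
  and their g-vectors in \<open>{x\<^sub>0, x\<^sub>1}\<close> depend linearly on the exponent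
  through \<open>\<gamma>\<close>. By the determinant identity \<open>\<gamma>\<close> is injective,
  so distinct monomials have distinct g-vectors and independence transfers from cluster 0.\<close>

lemma laurent_mon_indep:
  "\<forall>g D. (laurent_mon k g :: 'k::field_char_0 ratfun2) \<in> ratfun2.span (laurent_mon k ` D) \<longrightarrow> g \<in> D"
proof (intro allI impI, erule indep_if_nonneg_indep[rotated])
  fix g D
  assume g: "fst g \<ge> 0" "snd g \<ge> 0" and D: "\<And>h. h \<in> D \<Longrightarrow> fst h \<ge> 0 \<and> snd h \<ge> 0"
    and span: "(laurent_mon k g :: 'k ratfun2) \<in> ratfun2.span (laurent_mon k ` D)"
  define \<gamma> where "\<gamma> h = (fst h * gexp (- k) + snd h * gexp (- k - 1),
                  - (fst h * gexp (- k - 1) + snd h * gexp (- k - 2)))" for h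
  define Q where "Q = {h :: int \<times> int. fst h \<ge> 0 \<and> snd h \<ge> 0}"
  have \<gamma>: "has_gvector 0 (\<gamma> h) (laurent_mon k h :: 'k ratfun2)" if "h \<in> Q" for h
    using that has_gvector_cluster_monomial[of 0 "nat (fst h)" k "nat (snd h)", where 'k = 'k]
    by (simp add: laurent_mon_nonneg \<gamma>_def Q_def)
  have \<gamma>_inj: "h = h'" if "\<gamma> h = \<gamma> h'" for h h'
  proof -
    define a b c where "a = gexp (- k)" and "b = gexp (- k - 1)" and "c = gexp (- k - 2)"
    have det: "b * b - a * c = 1"
      using gexp_determinant[of "- k - 1"]
          by (simp add: a_def b_def c_def power2_eq_square algebra_simps)
    define u v where "u = fst h - fst h'" and "v = snd h - snd h'"
    have "u * a + v * b = 0" "u * b + v * c = 0"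
      using that by (simp_all add: \<gamma>_def u_def v_def a_def b_def c_def algebra_simps)
    then have "u * (b * b - a * c) = 0" "v * (b * b - a * c) = 0"
      by algebra+
    then show ?thesis
      using det by (simp add: u_def v_def prod_eq_iff)
  qed
  have mon_inj: "h = h'" if "h \<in> Q" "h' \<in> Q" "laurent_mon k h
      = (laurent_mon k h' :: 'k ratfun2)" for h h'
    using that \<gamma>[of h] \<gamma>[of h'] has_gvector_unique_if_indep[OF laurent_mon_indep_0] \<gamma>_inj by metis
  have "ratfun2.independent (laurent_mon k ` Q :: 'k ratfun2 set)"
  proof (rule independent_if_gvectors_if_indep[OF laurent_mon_indep_0])
    fix s s' :: "'k ratfun2" and i
    assume "s \<in> laurent_mon k ` Q" "s'
        \<in> laurent_mon k ` Q" and s: "has_gvector 0 i s" "has_gvector 0 i s'"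
    then obtain h h' where h: "h \<in> Q" "h' \<in> Q" "s = laurent_mon k h" "s' = laurent_mon k h'"
      by blast
    then have "\<gamma> h = i" "\<gamma> h' = i"
      using \<gamma> s has_gvector_unique_if_indep[OF laurent_mon_indep_0] by metis+
    then show "s = s'"
      using \<gamma>_inj h by metis
  qed (use \<gamma> in blast)+
  moreover have "laurent_mon k ` D \<subseteq> laurent_mon k ` Q - {laurent_mon k g :: 'k ratfun2}" if "g \<notin> D"
  proof
    fix f :: "'k ratfun2" assume "f \<in> laurent_mon k ` D"
    then obtain h where "h \<in> D" "f = laurent_mon k h" by blast
    then show "f \<in> laurent_mon k ` Q - {laurent_mon k g}"
      using that D g mon_inj[of h g] by (auto simp: Q_def)
  qed
  moreover have "g \<in> Q"
    using g by (simp add: Q_def)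
  ultimately show "g \<in> D"
    using span ratfun2.span_mono unfolding ratfun2.dependent_def by blast
qed

lemmas has_gvector_unique = has_gvector_unique_if_indep[OF laurent_mon_indep]
lemmas combination_gvectors = combination_gvectors_if_indep[OF laurent_mon_indep]
lemmas independent_if_gvectors = independent_if_gvectors_if_indep[OF laurent_mon_indep]

section \<open>Spanning\<close>

definition var_prod :: "int multiset \<Rightarrow> 'k::field_char_0 ratfun2" where
  "var_prod M = (\<Prod>m\<in>#M. cluster_var m)"

lemma var_prod_simps [simp]:
  "var_prod {#} = 1"
  "var_prod (add_mset m M) = cluster_var m * var_prod M"
  "var_prod (M + N) = var_prod M * var_prod N"
  by (simp_all add: var_prod_def)

lemma cluster_algebra_eq_span:
  "cluster_algebra = ratfun2.span (range (var_prod :: int multiset \<Rightarrow> 'k::field_char_0 ratfun2))"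
    (is "_ = ?S")
proof (intro equalityI subsetI)
  fix f :: "'k ratfun2"
  assume "f \<in> cluster_algebra"
  then show "f \<in> ?S"
  proof induction
    case (const c)
    have "kscale c (var_prod {#}) \<in> ?S"
      by (intro ratfun2.span_scale ratfun2.span_base rangeI)
    then show ?case by (simp add: kscale_one)
  next
    case (var m)
    have "var_prod {#m#} \<in> ?S"
      by (intro ratfun2.span_base rangeI)
    then show ?case by simp
  next
    case (mult f g)
    show ?case
      using mult.IH
    proof (rule span_mult)
      fix x y :: "'k ratfun2"
      assume "x \<in> range var_prod" "y \<in> range var_prod"
      then obtain M N where "x = var_prod M" "y = var_prod N" by blast
      then have "x * y = var_prod (M + N)" by simp
      then show "x * y \<in> ?S" by (simp add: ratfun2.span_base del: var_prod_simps)
    qed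
  qed (rule ratfun2.span_add)
next
  fix f :: "'k ratfun2"
  have prod: "var_prod M \<in> cluster_algebra" for M
    by (induction M)
       (auto intro: cluster_algebra.intros simp flip: const_1)
  assume "f \<in> ?S"
  then show "f \<in> cluster_algebra"
  proof (induction rule: ratfun2.span_induct_alt)
    case base
    show ?case using cluster_algebra.const[of 0] by simp
  next
    case (step c x y)
    then show ?case
      using prod by (auto simp: kscale_def intro!: cluster_algebra.intros)
  qed
qed

lemma in_cluster_algebra_if_span:
  "f \<in> ratfun2.span (cluster_algebra :: 'k::field_char_0 ratfun2 set) \<Longrightarrow> f \<in> cluster_algebra"
  unfolding cluster_algebra_eq_span by (simp add: ratfun2.span_span)

lemma power_cluster_algebra: "f \<in> cluster_algebra \<Longrightarrow> f ^ n \<in> cluster_algebra"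
  by (induction n) (auto intro: cluster_algebra.intros simp flip: const_1)

text \<open>Straightening \<open>x\<^sub>0 x\<^sub>3\<close> exhibits \<open>zed\<close> as
  \<open>x\<^sub>0 x\<^sub>3 - x\<^sub>1 x\<^sub>2\<close>.\<close>

lemma zed_cluster_algebra: "(zed :: 'k::field_char_0 ratfun2) \<in> cluster_algebra"
proof -
  have v3: "cluster_var 3 = zed * cluster_var 2 - (cluster_var 1 :: 'k ratfun2)"
    using zed_times_cluster_var[of 2, where 'k = 'k] by simp
  have v2: "cluster_var 0 * cluster_var 2 = cluster_var 1 ^ 2 + (1 :: 'k ratfun2)"
    using cluster_var_exchange[of 1, where 'k = 'k] by simp
  have v1: "zed * cluster_var 1 = cluster_var 0 + (cluster_var 2 :: 'k ratfun2)"
    using zed_times_cluster_var[of 1, where 'k = 'k] by simp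
  have "zed = cluster_var 0 * cluster_var 3 + const (-1) * (cluster_var 1 *
      (cluster_var 2 :: 'k ratfun2))"
  proof -
    have "cluster_var 0 * cluster_var 3 
      = zed * (cluster_var 0 * cluster_var 2) - cluster_var 0 * (cluster_var 1 :: 'k ratfun2)"
      by (simp add: v3 algebra_simps)
    also have "\<dots> = zed * cluster_var 1 * cluster_var 1 + zed - cluster_var 0 * cluster_var 1"
      by (simp add: v2 power2_eq_square algebra_simps)
    also have "\<dots> = zed + cluster_var 1 * cluster_var 2"
      by (simp add: v1 algebra_simps)
    finally show ?thesis
      by (simp flip: kscale_def)
  qed
  also have "\<dots> \<in> cluster_algebra"
    by (intro cluster_algebra.intros)
  finally show ?thesis .
qed

text \<open>Chebyshev polynomials of the second kind in \<open>zed\<close>, normalised so that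
  \<open>zed = t + 1/t\<close> gives \<open>t^n + t^(n-2) + ... + t^(-n)\<close>.\<close>

fun chebyshev :: "nat \<Rightarrow> 'k::field_char_0 ratfun2" where
  "chebyshev 0 = 1"
| "chebyshev (Suc 0) = zed"
| "chebyshev (Suc (Suc n)) = zed * chebyshev (Suc n) - chebyshev n"

text \<open>For fixed \<open>m\<close>, the sequences \<open>x_{m+2+n}\<close>,
  \<open>x_{m+1+n}\<close> and \<open>chebyshev n\<close> all satisfy
  \<open>u_{n+2} = zed u_{n+1} - u_n\<close>, so it suffices to check two initial values; the first
  of them is the exchange relation.\<close>

lemma cluster_var_mult_straighten:
  "cluster_var m * cluster_var (m + 2 + int n)
    = cluster_var (m + 1) * cluster_var (m + 1 + int n) + (chebyshev n :: 'k::field_char_0 ratfun2)"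
proof (induction n rule: chebyshev.induct)
  case 1
  show ?case
    using cluster_var_exchange[of "m + 1", where 'k = 'k]
        by (simp add: power2_eq_square add.commute)
next
  case 2
  have "cluster_var (m + 3) = zed * cluster_var (m + 2) - (cluster_var (m + 1) :: 'k ratfun2)"
    using zed_times_cluster_var[of "m + 2", where 'k = 'k] by (simp add: add.commute)
  moreover have "cluster_var m * cluster_var (m + 2) = cluster_var (m + 1) ^ 2 + (1 :: 'k ratfun2)"
    using cluster_var_exchange[of "m + 1", where 'k = 'k] by (simp add: add.commute)
  moreover have "zed * cluster_var (m + 1) = cluster_var m + (cluster_var (m + 2) :: 'k ratfun2)"
    using zed_times_cluster_var[of "m + 1", where 'k = 'k] by (simp add: add.commute)
  ultimately have "cluster_var m * cluster_var (m + 3)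
      = cluster_var (m + 1) * cluster_var (m + 2) + (zed :: 'k ratfun2)"
    by algebra
  then show ?case by (simp add: add.commute)
next
  case (3 n)
  define x :: "int \<Rightarrow> 'k ratfun2" where "x = cluster_var"
  have "x (m + 4 + int n) = zed * x (m + 3 + int n) - x (m + 2 + int n)"
    "x (m + 3 + int n) = zed * x (m + 2 + int n) - x (m + 1 + int n)"
    using zed_times_cluster_var[of "m + 3 + int n", where 'k = 'k]
      zed_times_cluster_var[of "m + 2 + int n", where 'k = 'k]
    by (simp_all add: x_def algebra_simps)
  moreover have "x m * x (m + 3 + int n) = x (m + 1) * x (m + 2 + int n) + chebyshev (Suc n)"
    using 3(1) by (simp add: x_def algebra_simps)
  moreover have "x m * x (m + 2 + int n) = x (m + 1) * x (m + 1 + int n) + chebyshev n"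
    using 3(2) by (simp add: x_def)
  ultimately have "x m * x (m + 4 + int n)
      = x (m + 1) * x (m + 3 + int n) + (zed * chebyshev (Suc n) - chebyshev n)"
    by algebra
  then show ?case
    by (simp add: x_def algebra_simps)
qed

text \<open>
  Since \<open>zed * x\<^sub>m = x\<^sub>m\<^sub>-\<^sub>1 + x\<^sub>m\<^sub>+\<^sub>1\<close>, multiplication by \<open>zed\<close> does not raise the degree in the
  cluster variables.
\<close>

lemma zed_mult_span:
  fixes f :: "'k::field_char_0 ratfun2"
  assumes "f \<in> ratfun2.span (var_prod ` {N. size N \<le> d} \<union> range (power zed))" (is "_ \<in> ?S")
  shows "zed * f \<in> ?S"
proof (rule span_mult[OF ratfun2.span_base[OF singletonI] assms])
  fix x y :: "'k ratfun2"
  assume x: "x \<in> {zed}" and y: "y \<in> var_prod ` {N. size N \<le> d} \<union> range (power zed)"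
  show "x * y \<in> ?S"
  proof (cases "y \<in> range (power zed)")
    case True
    then obtain n where "y = zed ^ n" by blast
    then have "x * y = zed ^ Suc n" using x by simp
    then show ?thesis by (metis UnI2 rangeI ratfun2.span_base)
  next
    case False
    then obtain N where N: "y = var_prod N" "size N \<le> d" using y by blast
    have "N \<noteq> {#}"
      using False N(1) by (metis power_0 rangeI var_prod_simps(1))
    then obtain m N' where N': "N = add_mset m N'"
      by (meson multiset_cases)
    have "x * y = zed * cluster_var m * var_prod N'"
      using x N N' by simp
    also have "\<dots> = var_prod (add_mset (m - 1) N') + var_prod (add_mset (m + 1) N')"
      by (simp add: zed_times_cluster_var distrib_right)
    also have "\<dots> \<in> ?S"
      using N N' by (intro ratfun2.span_add ratfun2.span_base UnI1 imageI) auto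
    finally show ?thesis .
  qed
qed

lemma chebyshev_mult_span:
  fixes f :: "'k::field_char_0 ratfun2"
  assumes "f \<in> ratfun2.span (var_prod ` {N. size N \<le> d} \<union> range (power zed))" (is "_ \<in> ?S")
  shows "chebyshev n * f \<in> ?S"
proof (induction n rule: chebyshev.induct)
  case (3 n)
  then have "zed * (chebyshev (Suc n) * f) - chebyshev n * f \<in> ?S"
    by (intro ratfun2.span_diff zed_mult_span)
  then show ?case by (simp add: algebra_simps)
qed (use assms zed_mult_span in auto)

text \<open>Induction on the degree and then on the sum of the squared indices. Straightening moves
  two indices at distance at least 2 towards each other, up to a Chebyshev multiple of a shorter
  product. When no such pair is left, all indices belong to one cluster.\<close>

lemma var_prod_in_span:
  "var_prod M \<in> ratfun2.span (cluster_monomials \<union> range (power (zed :: 'k::field_char_0 ratfun2)))"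
    (is "_ \<in> ?S")
proof (induction "size M" arbitrary: M rule: less_induct)
  case less
  define d where "d = size M"
  have small: "var_prod N \<in> ?S" if "size N < d" for N
    using less that by (simp add: d_def)
  have small_span: "ratfun2.span (var_prod ` {N. size N \<le> e} \<union> range (power zed)) \<subseteq> ?S"
      if "e < d" for e
  proof (rule ratfun2.span_minimal)
    show "var_prod ` {N. size N \<le> e} \<union> range (power zed) \<subseteq> ?S"
      using small that by (auto intro: ratfun2.span_base)
  qed (rule ratfun2.subspace_span)
  have "var_prod N \<in> ?S" if "size N = d" for N
    using that
  proof (induction "nat (\<Sum>m\<in>#N. m\<^sup>2)" arbitrary: N rule: less_induct)
    case (less N)
    show ?case
    proof (cases "\<exists>a b. a \<in># N \<and> b \<in># N \<and> a + 2 \<le> b")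
      case True
      then obtain a b where ab: "a \<in># N" "b \<in># N" "a + 2 \<le> b" by blast
      define N' where "N' = N - {#a, b#}"
      have N: "N = add_mset a (add_mset b N')"
      proof -
        have "b \<in># N - {#a#}" using ab by (intro in_diff_count[THEN iffD2]) (auto simp: not_in_iff)
        then show ?thesis
          using ab by (metis N'_def add_mset_add_single diff_add_mset_swap diff_union_single_conv
              insert_DiffM multi_member_split add_mset_diff_bothsides add_mset_remove_trivial)
      qed
      define n where "n = nat (b - a - 2)"
      have b: "b = a + 2 + int n" using ab by (simp add: n_def)
      let ?N = "add_mset (a + 1) (add_mset (a + 1 + int n) N')"
      have "var_prod N = cluster_var a * cluster_var (a + 2 + int n) * (var_prod N' :: 'k ratfun2)"
        by (simp add: N b)
      also have "\<dots> = var_prod ?N + chebyshev n * var_prod N'"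
        by (simp add: cluster_var_mult_straighten distrib_right)
      also have "\<dots> \<in> ?S"
      proof (rule ratfun2.span_add)
        \<comment> \<open>Since \<open>b = a + 2 + n\<close>, the sum of squares drops by
          \<open>2 * n + 2\<close>.\<close>
        have "(\<Sum>m\<in>#?N. m\<^sup>2) < (\<Sum>m\<in>#N. m\<^sup>2)"
          by (simp add: N b power2_eq_square algebra_simps)
        moreover have "(\<Sum>m\<in>#K. m\<^sup>2) \<ge> 0" for K :: "int multiset"
          by (induction K) auto
        ultimately have "nat (\<Sum>m\<in>#?N. m\<^sup>2) < nat (\<Sum>m\<in>#N. m\<^sup>2)"
          by (metis nat_less_eq_zless)
        then show "var_prod ?N \<in> ?S"
          using less.prems by (intro less.hyps) (auto simp: N)
        have "chebyshev n * var_prod N' \<in> ratfun2.span (var_prod ` {N. size N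
            \<le> size N'} \<union> range (power zed))"
          by (intro chebyshev_mult_span ratfun2.span_base) auto
        moreover have "size N' < d"
          using less.prems N by auto
        ultimately show "chebyshev n * var_prod N' \<in> ?S"
          using small_span by blast
      qed
      finally show ?thesis .
    next
      case False
      show ?thesis
      proof (cases "N = {#}")
        case True
        then have "var_prod N = (zed :: 'k ratfun2) ^ 0" by simp
        then show ?thesis by (metis UnI2 rangeI ratfun2.span_base)
      next
        case nonempty: False
        define j where "j = Min (set_mset N)"
        have "j \<in># N" using nonempty by (simp add: j_def)
        have "m = j \<or> m = j + 1" if "m \<in># N" for m
        proof -
          have "j \<le> m" using that by (simp add: j_def)
          moreover have "\<not> j + 2 \<le> m" using False that \<open>j \<in># N\<close> by blast
          ultimately show ?thesis by linarith
        qed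
        then have "N = replicate_mset (count N j) j + replicate_mset (count N (j + 1)) (j + 1)"
          by (intro multiset_eqI) (auto simp flip: not_in_iff)
        then have "var_prod N = cluster_var j ^ count N j * (cluster_var (j + 1) ^ count N (j
            + 1) :: 'k ratfun2)"
          by (metis var_prod_def var_prod_simps(3) image_replicate_mset prod_mset_replicate_mset)
        then have "var_prod N \<in> (cluster_monomials :: 'k ratfun2 set)"
          unfolding cluster_monomials_def by blast
        then show ?thesis
          by (simp add: ratfun2.span_base)
      qed
    qed
  qed
  then show ?case by (simp add: d_def)
qed

lemma cluster_algebra_span:
  "cluster_algebra = ratfun2.span (cluster_monomials \<union> range (power
      (zed :: 'k::field_char_0 ratfun2)))"
proof
  show "cluster_algebra \<subseteq> ratfun2.span (cluster_monomials \<union> range (power (zed :: 'k ratfun2)))"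
    unfolding cluster_algebra_eq_span
    by (rule ratfun2.span_minimal) (use var_prod_in_span ratfun2.subspace_span in auto)
  have "cluster_monomials \<union> range (power (zed :: 'k ratfun2)) \<subseteq> cluster_algebra"
    by (auto simp: cluster_monomials_def
             intro!: cluster_algebra.mult power_cluster_algebra cluster_algebra.var
                 zed_cluster_algebra)
  then show "ratfun2.span (cluster_monomials \<union> range (power (zed :: 'k ratfun2))) \<subseteq> cluster_algebra"
    using ratfun2.span_mono in_cluster_algebra_if_span by blast
qed

section \<open>The first coordinates of the g-vectors of a cluster monomial\<close>

definition mexp :: "nat \<Rightarrow> nat \<Rightarrow> int \<Rightarrow> int" where
  "mexp p q i = int p * gexp i + int q * gexp (i - 1)"

lemma has_gvector_mexp:
  "has_gvector k (mexp p q (k - j), - mexp p q (k - 1 - j))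
     (cluster_var j ^ p * (cluster_var (j + 1) ^ q :: 'k::field_char_0 ratfun2))"
  using has_gvector_cluster_monomial[of k p j q] by (simp add: mexp_def algebra_simps)

lemma mexp_nonneg_arg: "i \<ge> 0 \<Longrightarrow> mexp p q i = int (p + q) * i + int p"
  by (simp add: mexp_def gexp_def algebra_simps)

lemma mexp_neg_iff:
  "mexp p q i < 0 \<longleftrightarrow> i = -2 \<and> p > 0 \<or> i = -1 \<and> q > 0"
proof -
  consider "i \<le> -3" | "i = -2" | "i = -1" | "i \<ge> 0" by linarith
  then show ?thesis
  proof cases
    case 1
    then have "gexp i \<ge> 0" "gexp (i - 1) \<ge> 0" by (auto simp: gexp_def)
    then have "mexp p q i \<ge> 0" by (simp add: mexp_def)
    then show ?thesis using 1 by auto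
  next
    case 4
    then have "mexp p q i \<ge> 0" by (simp add: mexp_nonneg_arg)
    then show ?thesis using 4 by auto
  qed (auto simp: mexp_def gexp_def)
qed

lemma mexp_values: "mexp p q (-2) = - int p" "mexp p q (-1) = - int q"
  by (simp_all add: mexp_def gexp_def)

lemma linear_growth:
  fixes a b c :: int
  assumes "\<And>k. k \<ge> K \<Longrightarrow> a * k \<le> b * k + c"
  shows "a \<le> b"
proof (rule ccontr)
  assume "\<not> a \<le> b"
  define k where "k = max K (\<bar>c\<bar> + 1)"
  have "1 * k \<le> (a - b) * k"
    using \<open>\<not> a \<le> b\<close> by (intro mult_right_mono) (auto simp: k_def)
  moreover have "(a - b) * k \<le> c"
    using assms[of k] by (simp add: k_def algebra_simps)
  moreover have "c < k" by (simp add: k_def)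
  ultimately show False by linarith
qed

text \<open>For large \<open>k\<close> the exponent sequences are linear, with the total degrees as
  slopes.\<close>

lemma mexp_degree_le:
  assumes "\<And>k. mexp p' q' (k - j') \<le> mexp p q (k - j)"
  shows "p' + q' \<le> p + q"
proof -
  have "int (p' + q') \<le> int (p + q)"
  proof (rule linear_growth)
    fix k assume "k \<ge> max j j'"
    then show "int (p' + q') * k
        \<le> int (p + q) * k + (int (p' + q') * j' - int p' - int (p + q) * j + int p)"
      using assms[of k] by (simp add: mexp_nonneg_arg algebra_simps)
  qed
  then show ?thesis by linarith
qed

text \<open>A bounded sequence must have slope \<open>p + q = 0\<close>.\<close>

lemma mexp_bounded:
  assumes "\<And>k. mexp p q (k - j) \<le> n"
  shows "p = 0 \<and> q = 0"
proof -
  have "int (p + q) \<le> 0"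
  proof (rule linear_growth)
    fix k assume "k \<ge> j"
    then show "int (p + q) * k \<le> 0 * k + (n + int (p + q) * j - int p)"
      using assms[of k] by (simp add: mexp_nonneg_arg algebra_simps)
  qed
  then show ?thesis by simp
qed

text \<open>
  The exponent sequence of a cluster monomial is negative only at the two indices determined by
  its cluster, so that it is minimal among all exponent sequences.
\<close>

lemma mexp_minimal:
  assumes "\<And>k. mexp p' q' (k - j') \<le> mexp p q (k - j)"
  shows "cluster_var j' ^ p' * cluster_var (j' + 1) ^ q'
    = cluster_var j ^ p * (cluster_var (j + 1) ^ q :: 'k::field_char_0 ratfun2)"
proof -
  have deg: "p' + q' \<le> p + q"
    using assms by (rule mexp_degree_le)
  have p: "j' = j \<and> p \<le> p' \<or> j' = j - 1 \<and> p \<le> q'" if "p > 0"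
  proof -
    \<comment> \<open>At \<open>k = j - 2\<close> the dominating sequence has the value
      \<open>- p\<close>, so the other one is negative there, which happens only at its two special
      indices.\<close>
    have le: "mexp p' q' (j - 2 - j') \<le> - int p"
      using assms[of "j - 2"] by (simp add: mexp_values)
    then have "j - 2 - j' = -2 \<or> j - 2 - j' = -1"
      using mexp_neg_iff[of p' q' "j - 2 - j'"] that by linarith
    then show ?thesis
      using le by (elim disjE) (auto simp: mexp_values)
  qed
  have q: "j' = j + 1 \<and> q \<le> p' \<or> j' = j \<and> q \<le> q'" if "q > 0"
  proof -
    have le: "mexp p' q' (j - 1 - j') \<le> - int q"
      using assms[of "j - 1"] by (simp add: mexp_values)
    then have "j - 1 - j' = -2 \<or> j - 1 - j' = -1"
      using mexp_neg_iff[of p' q' "j - 1 - j'"] that by linarith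
    then show ?thesis
      using le by (elim disjE) (auto simp: mexp_values)
  qed
  consider "p = 0" "q = 0" | "p > 0" "q = 0" | "p = 0" "q > 0" | "p > 0" "q > 0" by blast
  then show ?thesis
  proof cases
    case 1
    then show ?thesis using deg by simp
  next
    case 2
    then consider "j' = j" "p' = p" "q' = 0" | "j' = j - 1" "p' = 0" "q' = p"
      using p deg by fastforce
    then show ?thesis using 2 by cases auto
  next
    case 3
    then consider "j' = j + 1" "p' = q" "q' = 0" | "j' = j" "p' = 0" "q' = q"
      using q deg by fastforce
    then show ?thesis using 3 by cases auto
  next
    case 4
    then have "j' = j" "p' = p" "q' = q"
      using p q deg by fastforce+
    then show ?thesis by simp
  qed
qed

section \<open>Mutation of g-vectors\<close>

text \<open>
  \<open>f\<close> stands for the g-vectors \<open>(f k, - f (k - 1))\<close>, \<open>k \<in> \<int>\<close>; the recursion is the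
  piecewise linear mutation of g-vectors between neighbouring clusters.
\<close>

definition mutation_seq :: "(int \<Rightarrow> int) \<Rightarrow> bool" where
  "mutation_seq f \<longleftrightarrow> (\<forall>k. f (k + 1) + f (k - 1) = 2 * max (f k) 0)"

lemma mutation_seq_mexp: "mutation_seq (\<lambda>k. mexp p q (k - j))"
proof -
  have "mexp p q (i + 1) + mexp p q (i - 1) = 2 * max (mexp p q i) 0" for i
  proof -
    consider "i \<le> -4" | "i = -3" | "i = -2" | "i = -1" | "i = 0" | "i \<ge> 1" by linarith
    then show ?thesis
    proof cases
      case 1
      then have "mexp p q i \<ge> 0" using mexp_neg_iff[of p q i] by linarith
      then show ?thesis using 1 by (simp add: mexp_def gexp_def algebra_simps)
    next
      case 6
      then have "mexp p q i \<ge> 0" using mexp_neg_iff[of p q i] by linarith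
      then show ?thesis using 6 by (simp add: mexp_def gexp_def algebra_simps)
    qed (simp_all add: mexp_def gexp_def)
  qed
  from this[of "k - j" for k] show ?thesis
    by (simp add: mutation_seq_def algebra_simps)
qed

lemma mutation_seq_const: "mutation_seq (\<lambda>_. int n)"
  by (simp add: mutation_seq_def)

text \<open>The recursion runs in both directions, so the g-vector in one cluster determines those
  in all clusters.\<close>

lemma mutation_seq_unique:
  assumes f: "mutation_seq f" and f': "mutation_seq f'" and k: "f k = f' k" "f (k - 1) = f' (k - 1)"
  shows "f i = f' i"
proof -
  have up: "f (j + 1) = f' (j + 1)" if "f j = f' j" "f (j - 1) = f' (j - 1)" for j
    using f f' that unfolding mutation_seq_def by (metis add_right_cancel)
  have down: "f (j - 1) = f' (j - 1)" if "f j = f' j" "f (j + 1) = f' (j + 1)" for j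
    using f f' that unfolding mutation_seq_def by (metis add_left_cancel)
  have "f i = f' i \<and> f (i - 1) = f' (i - 1)"
  proof (induction i rule: int_induct[where k = k])
    case base
    then show ?case using k by simp
  next
    case (step1 i)
    then show ?case using up[of i] by simp
  next
    case (step2 i)
    then show ?case using down[of "i - 1"] by simp
  qed
  then show ?thesis by simp
qed

section \<open>Bases containing the cluster monomials\<close>

definition imag_elem :: "nat \<Rightarrow> (nat \<Rightarrow> 'k) \<Rightarrow> 'k::field_char_0 ratfun2" where
  "imag_elem n c = (\<Sum>r\<le>n div 2. kscale (c r) (zed ^ (n - 2 * r)))"

lemma imag_elem_eq:
  assumes "c 0 = 1"
  shows "imag_elem n c = zed ^ n + (\<Sum>r\<in>{1..n div 2}. kscale (c r) (zed ^ (n - 2 * r)))"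
proof -
  have "{..n div 2} = insert 0 {1..n div 2}" by auto
  then show ?thesis
    using assms by (simp add: imag_elem_def)
qed

lemma imag_elem_cong: "(\<And>r. r \<le> n div 2 \<Longrightarrow> c r = d r) \<Longrightarrow> imag_elem n c = imag_elem n d"
  by (simp add: imag_elem_def)

lemma has_gvector_zed_power: "has_gvector k (int n, - int n) (zed ^ n :: 'k::field_char_0 ratfun2)"
  using has_gvector_power[OF has_gvector_zed, of k n] by simp

text \<open>Lowering the degree of a power of \<open>zed\<close> by \<open>2 * r\<close> amounts to
  \<open>r\<close> cone steps in each coordinate, so the lower terms are absorbed; it is the common
  parity that makes this work.\<close>

lemma has_gvector_imag_elem:
  fixes c :: "nat \<Rightarrow> 'k::field_char_0"
  assumes "c 0 = 1"
  shows "has_gvector k (int n, - int n) (imag_elem n c)"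
proof -
  have "has_gvector k (int n, - int n) (zed ^ n + (\<Sum>r\<in>R. kscale (c r) (zed ^ (n - 2 * r))))"
    if "finite R" "R \<subseteq> {1..n div 2}" for R
    using that
  proof (induction R)
    case empty
    show ?case by (simp add: has_gvector_zed_power)
  next
    case (insert r R)
    have "(int (n - 2 * r), - int (n - 2 * r)) \<in> cone (int n, - int n)"
      unfolding cone_def
      by (rule CollectI, rule exI[of _ r], rule exI[of _ r]) (use insert.prems in auto)
    then have "has_gvector k (int n, - int n) (zed ^ n + (\<Sum>r\<in>R. kscale (c r) (zed ^ (n - 2 * r)))
        + kscale (c r) (zed ^ (n - 2 * r)))"
      using insert.prems by (intro has_gvector_add_scale[OF _ has_gvector_zed_power] insert.IH) auto
    then show ?case
      using insert.hyps by (simp add: algebra_simps)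
  qed
  then show ?thesis
    using assms by (simp add: imag_elem_eq)
qed

definition monic_basis :: "(nat \<Rightarrow> nat \<Rightarrow> 'k) \<Rightarrow> 'k::field_char_0 ratfun2 set" where
  "monic_basis c = cluster_monomials \<union> {imag_elem n (c n) | n. n \<ge> 1}"

context
  fixes c :: "nat \<Rightarrow> nat \<Rightarrow> 'k::field_char_0"
  assumes c: "\<And>n. n \<ge> 1 \<Longrightarrow> c n 0 = 1"
begin

lemma monic_basis_gvectors:
  assumes "b \<in> monic_basis c"
  obtains f where "mutation_seq f" "\<And>k. has_gvector k (f k, - f (k - 1)) b"
proof (cases "b \<in> cluster_monomials")
  case True
  then obtain j p q where "b = cluster_var j ^ p * cluster_var (j + 1) ^ q"
    unfolding cluster_monomials_def by blast
  then show ?thesis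
    using that[OF mutation_seq_mexp[of p q j]] has_gvector_mexp by metis
next
  case False
  then obtain n where n: "b = imag_elem n (c n)" "n \<ge> 1"
    using assms unfolding monic_basis_def by blast
  show ?thesis
    by (rule that[OF mutation_seq_const[of n]]) (use n c has_gvector_imag_elem in auto)
qed

text \<open>Agreement in one cluster spreads to all clusters by mutation. The whole sequence
  identifies a cluster monomial, and it is the constant \<open>n\<close> for the element of degree
  \<open>n\<close> in \<open>zed\<close>, whereas a cluster monomial attains a value
  \<open>- p\<close>, which is not positive.\<close>

lemma monic_basis_gvector_inj:
  assumes b: "b \<in> monic_basis c" "b'
      \<in> monic_basis c" and g: "has_gvector k g b" "has_gvector k g b'"
  shows "b = b'"
proof -
  obtain f where f: "mutation_seq f" "\<And>k. has_gvector k (f k, - f (k - 1)) b"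
    using monic_basis_gvectors[OF b(1)] by metis
  obtain f' where f': "mutation_seq f'" "\<And>k. has_gvector k (f' k, - f' (k - 1)) b'"
    using monic_basis_gvectors[OF b(2)] by metis
  have "(f k, - f (k - 1)) = g" "(f' k, - f' (k - 1)) = g"
    using has_gvector_unique[OF f(2) g(1)] has_gvector_unique[OF f'(2) g(2)] by simp_all
  then have fk: "f k = f' k" "f (k - 1) = f' (k - 1)"
    by (metis fst_conv, metis snd_conv minus_minus)
  have "f = f'"
    by (rule ext) (rule mutation_seq_unique[OF f(1) f'(1) fk])
  have seq: "f k = fst g" if "has_gvector k g b" for g k
    using has_gvector_unique[OF f(2) that] by auto
  have seq': "f k = fst g" if "has_gvector k g b'" for g k
    using has_gvector_unique[OF f'(2) that] \<open>f = f'\<close> by auto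
  have imag: "f k = int n" if "n \<ge> 1" "b = imag_elem n (c n) \<or> b' = imag_elem n (c n)" for n k
    using has_gvector_imag_elem[where c = "c n" and n = n and k = k] c that seq[of k] seq'[of k]
        by auto
  have not_imag: "\<not> (\<forall>k. f k = int n)"
      if n1: "n \<ge> 1" and cm: "b \<in> cluster_monomials \<or> b' \<in> cluster_monomials" for n
  proof
    assume n: "\<forall>k. f k = int n"
    obtain j p q where "b = cluster_var j ^ p * cluster_var (j + 1) ^ q
        \<or> b' = cluster_var j ^ p * cluster_var (j + 1) ^ q"
      using cm unfolding cluster_monomials_def by blast
    then have "f (j - 2) = mexp p q (-2)"
      using has_gvector_mexp[of "j - 2" p q j, where 'k = 'k] seq[of "j - 2"] seq'[of "j - 2"]
          by auto
    then show False
      using n n1 by (simp add: mexp_values)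
  qed
  show ?thesis
  proof (cases "b \<in> cluster_monomials \<and> b' \<in> cluster_monomials")
    case True
    then obtain j p q j' p' q' where eq:
      "b = cluster_var j ^ p * cluster_var (j + 1) ^ q"
      "b' = cluster_var j' ^ p' * cluster_var (j' + 1) ^ q'"
      unfolding cluster_monomials_def by blast
    have "f k = mexp p q (k - j)" "f k = mexp p' q' (k - j')" for k
      using seq[of k] seq'[of k] has_gvector_mexp[of k p q j, where 'k = 'k]
        has_gvector_mexp[of k p' q' j', where 'k = 'k] eq by auto
    then show ?thesis
      unfolding eq by (intro mexp_minimal) (metis order_refl)
  next
    case False
    then obtain n where n: "n \<ge> 1" "b = imag_elem n (c n) \<or> b' = imag_elem n (c n)"
      using b unfolding monic_basis_def by blast
    then have "\<forall>k. f k = int n"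
      using imag by blast
    then have "b \<notin> cluster_monomials" "b' \<notin> cluster_monomials"
      using not_imag n(1) by blast+
    then obtain m m' where "m \<ge> 1" "m' \<ge> 1" "b = imag_elem m (c m)" "b' = imag_elem m' (c m')"
      using b unfolding monic_basis_def by blast
    moreover from this have "int m = int m'"
      using imag[of m 0] imag[of m' 0] by simp
    ultimately show ?thesis by simp
  qed
qed

lemma monic_basis_subset: "monic_basis c \<subseteq> cluster_algebra"
proof -
  have "zed ^ m \<in> (cluster_algebra :: 'k ratfun2 set)" for m
    by (intro power_cluster_algebra zed_cluster_algebra)
  then have "imag_elem n d \<in> (cluster_algebra :: 'k ratfun2 set)" for n d
    unfolding imag_elem_def
    by (intro in_cluster_algebra_if_span[OF ratfun2.span_sum] ratfun2.span_scale ratfun2.span_base)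
  then show ?thesis
    by (auto simp: monic_basis_def cluster_monomials_def
             intro!: cluster_algebra.mult power_cluster_algebra cluster_algebra.var)
qed

text \<open>Independence follows from the g-vectors in a single cluster. For spanning, powers of
  \<open>zed\<close> are recovered by a unitriangular recursion that ends at the cluster monomial 1
  or at \<open>zed\<close>.\<close>

lemma linear_basis_monic_basis: "linear_basis (monic_basis c)"
  unfolding linear_basis_def
proof
  show "ratfun2.independent (monic_basis c)"
  proof (rule independent_if_gvectors[where k = 0])
    show "\<exists>g. has_gvector 0 g s" if "s \<in> monic_basis c" for s
      using monic_basis_gvectors[OF that] by blast
  qed (rule monic_basis_gvector_inj)
  show "ratfun2.span (monic_basis c) = cluster_algebra"
  proof
    show "ratfun2.span (monic_basis c) \<subseteq> cluster_algebra"
      using ratfun2.span_mono[OF monic_basis_subset] in_cluster_algebra_if_span by blast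
    have zed: "zed ^ n \<in> ratfun2.span (monic_basis c)" for n
    proof (induction n rule: less_induct)
      case (less n)
      show ?case
      proof (cases "n = 0")
        case True
        have "zed ^ n = cluster_var 0 ^ 0 * (cluster_var (0 + 1) ^ 0 :: 'k ratfun2)"
          using True by simp
        then have "zed ^ n \<in> (cluster_monomials :: 'k ratfun2 set)"
          unfolding cluster_monomials_def by blast
        then show ?thesis by (simp add: monic_basis_def ratfun2.span_base)
      next
        case False
        then have "zed ^ n = imag_elem n (c n) - (\<Sum>r\<in>{1..n div 2}. kscale (c n r) (zed ^ (n - 2
            * r)))"
          using c by (simp add: imag_elem_eq)
        also have "\<dots> \<in> ratfun2.span (monic_basis c)"
        proof (intro ratfun2.span_diff ratfun2.span_sum ratfun2.span_scale less)
          show "imag_elem n (c n) \<in> ratfun2.span (monic_basis c)"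
            by (rule ratfun2.span_base) (use False in \<open>auto simp: monic_basis_def\<close>)
        qed auto
        finally show ?thesis .
      qed
    qed
    show "cluster_algebra \<subseteq> ratfun2.span (monic_basis c)"
      unfolding cluster_algebra_span
      by (rule ratfun2.span_minimal)
         (use zed in \<open>auto simp: monic_basis_def ratfun2.span_base\<close>)
  qed
qed

lemma pointed_basis_monic_basis: "pointed_basis (monic_basis c)"
  unfolding pointed_basis_def pointed_def
proof (intro conjI ballI allI impI)
  show "linear_basis (monic_basis c)"
    by (rule linear_basis_monic_basis)
  show "z \<in> cluster_algebra" if "z \<in> monic_basis c" for z
    using that monic_basis_subset by blast
  show "\<exists>g. has_gvector k g z" if "z \<in> monic_basis c" for z k
    using monic_basis_gvectors[OF that] by blast
qed (rule monic_basis_gvector_inj)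

end

section \<open>Every pointed basis contains the cluster monomials\<close>

lemma has_gvector_in_span:
  fixes f :: "'k::field_char_0 ratfun2"
  assumes "has_gvector k g f"
  shows "f \<in> ratfun2.span (laurent_mon k ` {h. fst h \<le> fst g})"
proof -
  have "below g \<subseteq> {h. fst h \<le> fst g}"
    by (auto simp: below_def)
  then have "f - laurent_mon k g \<in> ratfun2.span (laurent_mon k ` {h. fst h \<le> fst g})"
    using has_gvector_below[OF assms] ratfun2.span_mono[OF image_mono] by blast
  moreover have "laurent_mon k g \<in> ratfun2.span (laurent_mon k ` {h. fst h \<le> fst g})"
    by (intro ratfun2.span_base imageI) auto
  ultimately show ?thesis
    by (metis ratfun2.span_add diff_add_cancel)
qed

text \<open>The leading term with respect to \<open>below\<close> is unique, and a g-vector fixes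
  its coefficient to be 1.\<close>

lemma leading_coeff_unique:
  fixes f :: "'k::field_char_0 ratfun2"
  assumes f: "f - kscale c (laurent_mon k g) \<in> ratfun2.span (laurent_mon k ` below g)"
    and c: "c \<noteq> 0" and h: "has_gvector k h f"
  shows "h = g \<and> c = 1"
proof -
  let ?S = "\<lambda>g. ratfun2.span (laurent_mon k ` below g) :: 'k ratfun2 set"
  have contra: False if "kscale d (laurent_mon k i) \<in> ?S i" "d \<noteq> 0" for d i
  proof -
    have "kscale (inverse d) (kscale d (laurent_mon k i)) \<in> ?S i"
      using that(1) by (rule ratfun2.span_scale)
    then have "i \<in> below i"
      using that(2) laurent_mon_indep[rule_format] by simp
    then show False using below_irrefl by blast
  qed
  have leq: "?S i \<subseteq> ?S j" if "i \<in> below j" for i j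
    by (rule ratfun2.span_mono, rule image_mono) (use that below_trans in blast)
  have base: "laurent_mon k i \<in> ?S j" if "i \<in> below j" for i j
    using that by (intro ratfun2.span_base imageI)
  have h': "f - laurent_mon k h \<in> ?S h"
    using h by (rule has_gvector_below)
  have "h = g"
  proof (rule ccontr)
    assume "h \<noteq> g"
    then consider "h \<in> below g" | "g \<in> below h"
      using below_linear by blast
    then show False
    proof cases
      case 1
      then have "f - laurent_mon k h \<in> ?S g"
        using h' leq by blast
      from ratfun2.span_add[OF this base[OF 1]] have "f \<in> ?S g"
        by simp
      from ratfun2.span_diff[OF this f] show False
        using contra[of c g] c by simp
    next
      case 2
      then have "f - kscale c (laurent_mon k g) \<in> ?S h"
        using f leq by blast
      from ratfun2.span_add[OF this ratfun2.span_scale[OF base[OF 2]]] have "f \<in> ?S h"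
        by (metis diff_add_cancel)
      from ratfun2.span_diff[OF this h'] show False
        using contra[of 1 h] by simp
    qed
  qed
  moreover have "c = 1"
  proof (rule ccontr)
    assume "c \<noteq> 1"
    have "(f - laurent_mon k g) - (f - kscale c (laurent_mon k g)) \<in> ?S g"
      by (rule ratfun2.span_diff) (use h' f \<open>h = g\<close> in auto)
    also have "(f - laurent_mon k g) - (f - kscale c (laurent_mon k g))
        = kscale (c - 1) (laurent_mon k g)"
      by (simp add: ratfun2.scale_left_diff_distrib)
    finally show False
      using contra[of "c - 1" g] \<open>c \<noteq> 1\<close> by simp
  qed
  ultimately show ?thesis by blast
qed

lemma scaled_gvector:
  fixes f :: "'k::field_char_0 ratfun2"
  assumes "has_gvector k g f" "has_gvector k h (kscale c f)"
  shows "c = 1"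
proof (cases "c = 0")
  case True
  then have "- laurent_mon k h \<in> ratfun2.span (laurent_mon k ` below h :: 'k ratfun2 set)"
    using has_gvector_below[OF assms(2)] by simp
  then have "h \<in> below h"
    using laurent_mon_indep ratfun2.span_neg by fastforce
  then show ?thesis using below_irrefl by blast
next
  case False
  have "kscale c f - kscale c (laurent_mon k g) \<in> ratfun2.span (laurent_mon k ` below g)"
    using has_gvector_below[OF assms(1)]
    by (metis ratfun2.span_scale ratfun2.scale_right_diff_distrib)
  then show ?thesis
    using leading_coeff_unique False assms(2) by blast
qed

text \<open>The exponents with first coordinate at most \<open>F k\<close> are closed under
  \<open>below\<close>, so \<open>combination_gvectors\<close> applies. One and the same expansion
  of \<open>f\<close> satisfies the bounds for all \<open>k\<close>.\<close>

lemma dominated_expansion: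
  fixes S :: "'k::field_char_0 ratfun2 set"
  assumes gv: "\<And>s k. s \<in> S \<Longrightarrow> \<exists>g. has_gvector k g s"
    and inj: "\<And>s s' k g. s \<in> S \<Longrightarrow> s' \<in> S \<Longrightarrow> has_gvector k g s \<Longrightarrow> has_gvector k g s' \<Longrightarrow> s = s'"
    and f: "f \<in> ratfun2.span S" "\<And>k. f \<in> ratfun2.span (laurent_mon k ` {h. fst h \<le> F k})"
  shows "f \<in> ratfun2.span {s \<in> S. \<forall>k g. has_gvector k g s \<longrightarrow> fst g \<le> F k}"
proof -
  obtain T c where T: "finite T" "T \<subseteq> S" "f = (\<Sum>s\<in>T. kscale (c s) s)"
    using f(1) unfolding ratfun2.span_explicit by blast
  have bound: "fst g \<le> F k" if s: "s \<in> T" "c s \<noteq> 0" and g: "has_gvector k g s" for s k g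
  proof -
    have "\<forall>s\<in>S. \<exists>g. has_gvector k g s"
      using gv by blast
    then obtain \<gamma> where \<gamma>: "\<And>s. s \<in> S \<Longrightarrow> has_gvector k (\<gamma> s) s"
      by metis
    have "inj_on \<gamma> T"
      using \<gamma> inj T(2) by (metis inj_onI subsetD)
    then have "\<gamma> s \<in> {h. fst h \<le> F k}"
      using T s \<gamma> f(2)[of k]
      by (intro combination_gvectors[of T k \<gamma> c]) (auto simp: below_def)
    moreover have "\<gamma> s = g"
      using has_gvector_unique[OF \<gamma> g] T(2) s(1) by blast
    ultimately show ?thesis by simp
  qed
  have "f = (\<Sum>s\<in>{s \<in> T. c s \<noteq> 0}. kscale (c s) s)"
    unfolding T(3) using T(1) by (intro sum.mono_neutral_right) auto
  also have "\<dots> \<in> ratfun2.span {s \<in> S. \<forall>k g. has_gvector k g s \<longrightarrow> fst g \<le> F k}"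
    using T(2) bound by (intro ratfun2.span_sum ratfun2.span_scale ratfun2.span_base) auto
  finally show ?thesis .
qed

text \<open>Makes \<open>monic_basis\<close> consist of the cluster monomials and the powers of
  \<open>zed\<close>, a reference basis with which an arbitrary pointed basis is compared.\<close>

definition zed_coeffs :: "nat \<Rightarrow> nat \<Rightarrow> 'k::field_char_0" where
  "zed_coeffs n r = (if r = 0 then 1 else 0)"

lemma imag_elem_zed_coeffs: "imag_elem n (zed_coeffs n) = (zed ^ n :: 'k::field_char_0 ratfun2)"
  by (simp add: imag_elem_eq zed_coeffs_def)

section \<open>Comparison of an arbitrary pointed basis with the reference basis\<close>

context
  fixes B :: "'k::field_char_0 ratfun2 set"
  assumes B: "pointed_basis B"
begin

lemma pointed_basis_gvector: "s \<in> B \<Longrightarrow> \<exists>g. has_gvector k g s"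
  using B unfolding pointed_basis_def pointed_def by blast

lemma pointed_basis_inj: "s \<in> B \<Longrightarrow> s' \<in> B \<Longrightarrow> has_gvector k g s \<Longrightarrow> has_gvector k g s' \<Longrightarrow> s = s'"
  using B unfolding pointed_basis_def by blast

lemma pointed_basis_span: "ratfun2.span B = cluster_algebra"
  using B unfolding pointed_basis_def linear_basis_def by blast

text \<open>
  By the maximality of leading exponents, expanding first in \<open>B\<close> and then in the basis of cluster
  monomials and powers of \<open>zed\<close> never raises the degree in any cluster.
\<close>

lemma pointed_basis_dominated:
  fixes F :: "int \<Rightarrow> int"
  defines "X \<equiv> {b \<in> B. \<forall>k g. has_gvector k g b \<longrightarrow> fst g \<le> F k}"
    and "Y \<equiv> {r \<in> monic_basis zed_coeffs :: 'k ratfun2 set. \<forall>k g. has_gvector k g r \<longrightarrow> fst g \<le> F k}"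
  assumes f: "f \<in> cluster_algebra" "\<And>k. f \<in> ratfun2.span (laurent_mon k ` {h. fst h \<le> F k})"
  shows "f \<in> ratfun2.span X" and "X \<subseteq> ratfun2.span Y"
proof -
  have c: "n \<ge> 1 \<Longrightarrow> zed_coeffs n 0 = (1 :: 'k)" for n
    by (simp add: zed_coeffs_def)
  show "f \<in> ratfun2.span X"
    unfolding X_def
    by (rule dominated_expansion[OF pointed_basis_gvector pointed_basis_inj])
       (use f pointed_basis_span in auto)
  show "X \<subseteq> ratfun2.span Y"
  proof
    fix b assume b: "b \<in> X"
    show "b \<in> ratfun2.span Y"
      unfolding Y_def
    proof (rule dominated_expansion)
      show "\<exists>g. has_gvector k g s" if "s \<in> monic_basis zed_coeffs" for s :: "'k ratfun2" and k
        using monic_basis_gvectors[where c = zed_coeffs, OF c that] by metis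
      show "s = s'" if "s \<in> monic_basis zed_coeffs" "s' \<in> monic_basis zed_coeffs"
        "has_gvector k g s" "has_gvector k g s'" for s s' :: "'k ratfun2" and k g
        using monic_basis_gvector_inj[where c = zed_coeffs, OF c that] .
      show "b \<in> ratfun2.span (monic_basis zed_coeffs)"
        using b B linear_basis_monic_basis[where c = zed_coeffs, OF c]
        unfolding X_def pointed_basis_def pointed_def linear_basis_def by auto
      show "b \<in> ratfun2.span (laurent_mon k ` {h. fst h \<le> F k})" for k
      proof -
        obtain g where g: "has_gvector k g b"
          using pointed_basis_gvector b X_def by blast
        then have "fst g \<le> F k"
          using b unfolding X_def by blast
        then have "{h :: int \<times> int. fst h \<le> fst g} \<subseteq> {h. fst h \<le> F k}"
          by auto
        then show ?thesis
          using has_gvector_in_span[OF g] ratfun2.span_mono[OF image_mono] by blast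
      qed
    qed
  qed
qed

text \<open>Among the reference elements only \<open>m\<close> is dominated by \<open>m\<close>, so
  every dominated element of \<open>B\<close> is a multiple of \<open>m\<close>, hence equal to
  \<open>m\<close> as it is pointed. Such an element exists because \<open>m\<close> is
  nonzero.\<close>

lemma cluster_monomials_subset_pointed_basis: "cluster_monomials \<subseteq> B"
proof
  fix m :: "'k ratfun2" assume "m \<in> cluster_monomials"
  then obtain j p q where m: "m = cluster_var j ^ p * cluster_var (j + 1) ^ q"
    unfolding cluster_monomials_def by blast
  define F where "F k = mexp p q (k - j)" for k
  have gm: "has_gvector k (F k, - F (k - 1)) m" for k
    using has_gvector_mexp[of k p q j, where 'k = 'k] by (simp add: m F_def)
  define X where "X = {b \<in> B. \<forall>k g. has_gvector k g b \<longrightarrow> fst g \<le> F k}"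
  define Y where "Y = {r \<in> monic_basis zed_coeffs :: 'k ratfun2 set. \<forall>k g. has_gvector k g r \<longrightarrow> fst
      g \<le> F k}"
  have "m \<in> cluster_algebra"
    unfolding m by (intro cluster_algebra.mult power_cluster_algebra cluster_algebra.var)
  then have mX: "m \<in> ratfun2.span X" and XY: "X \<subseteq> ratfun2.span Y"
    using pointed_basis_dominated[of m F] has_gvector_in_span[OF gm] unfolding X_def Y_def
        by simp_all
  have "Y \<subseteq> {m}"
  proof
    fix r assume r: "r \<in> Y"
    show "r \<in> {m}"
    proof (cases "r \<in> cluster_monomials")
      case True
      then obtain j' p' q' where r': "r = cluster_var j' ^ p' * cluster_var (j' + 1) ^ q'"
        unfolding cluster_monomials_def by blast
      have "mexp p' q' (k - j') \<le> mexp p q (k - j)" for k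
        using r has_gvector_mexp[of k p' q' j', where 'k = 'k] unfolding Y_def r' F_def by fastforce
      then show ?thesis
        unfolding r' m by (simp add: mexp_minimal)
    next
      case False
      then obtain n where n: "n \<ge> 1" "r = zed ^ n"
        using r unfolding Y_def monic_basis_def imag_elem_zed_coeffs by blast
      \<comment> \<open>Here \<open>F\<close> has the value \<open>- p\<close>, which excludes
        positive powers of \<open>zed\<close>.\<close>
      then have "int n \<le> F (j - 2)"
        using r has_gvector_zed_power[of "j - 2" n, where 'k = 'k] unfolding Y_def by fastforce
      then show ?thesis
        using n by (simp add: F_def mexp_values)
    qed
  qed
  then have "X \<subseteq> {m}"
  proof (intro subsetI)
    fix b assume b: "b \<in> X"
    then have "b \<in> ratfun2.span {m}"
      using XY ratfun2.span_mono[OF \<open>Y \<subseteq> {m}\<close>] by blast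
    then obtain d where d: "b = kscale d m"
      unfolding ratfun2.span_singleton by blast
    obtain g where "has_gvector 0 g b"
      using b pointed_basis_gvector unfolding X_def by blast
    then have "d = 1"
      using scaled_gvector gm d by blast
    then show "b \<in> {m}"
      using d by simp
  qed
  moreover have "X \<noteq> {}"
  proof
    assume "X = {}"
    then have "m = 0" using mX by simp
    then show False
      by (simp add: m cluster_var_nonzero)
  qed
  ultimately show "m \<in> B"
    unfolding X_def by blast
qed

text \<open>The elements of \<open>B\<close> dominated by the constant \<open>n\<close> are
  polynomials in \<open>zed\<close> of degree at most \<open>n\<close>, and one has degree
  \<open>n\<close> because \<open>zed ^ n\<close> is in their span. Pointedness makes it monic and
  excludes terms of the wrong parity.\<close>

lemma imag_elem_in_pointed_basis:
  assumes n: "n \<ge> 1"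
  shows "\<exists>c. c 0 = 1 \<and> imag_elem n c \<in> B"
proof -
  define X where "X = {b \<in> B. \<forall>k g. has_gvector k g b \<longrightarrow> fst g \<le> int n}"
  define Y where "Y = {r \<in> monic_basis zed_coeffs :: 'k ratfun2 set. \<forall>k g. has_gvector k g r \<longrightarrow> fst
      g \<le> int n}"
  have "zed ^ n \<in> (cluster_algebra :: 'k ratfun2 set)"
    by (intro power_cluster_algebra zed_cluster_algebra)
  then have zX: "zed ^ n \<in> ratfun2.span X" and XY: "X \<subseteq> ratfun2.span Y"
    using pointed_basis_dominated[of "zed ^ n" "\<lambda>_. int n"] has_gvector_in_span[OF
        has_gvector_zed_power[of _ n, where 'k = 'k]]
    unfolding X_def Y_def by simp_all
  have "Y \<subseteq> (\<lambda>m. zed ^ m) ` {..n}"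
  proof
    fix r assume r: "r \<in> Y"
    show "r \<in> (\<lambda>m. zed ^ m) ` {..n}"
    proof (cases "r \<in> cluster_monomials")
      case True
      then obtain j p q where r': "r = cluster_var j ^ p * cluster_var (j + 1) ^ q"
        unfolding cluster_monomials_def by blast
      have "mexp p q (k - j) \<le> int n" for k
        using r has_gvector_mexp[of k p q j, where 'k = 'k] unfolding Y_def r' by fastforce
      then have "p = 0 \<and> q = 0"
        by (rule mexp_bounded)
      then have "r = zed ^ 0"
        by (simp add: r')
      then show ?thesis by blast
    next
      case False
      then obtain m where m: "r = zed ^ m"
        using r unfolding Y_def monic_basis_def imag_elem_zed_coeffs by blast
      then have "m \<le> n"
        using r has_gvector_zed_power[of 0 m, where 'k = 'k] unfolding Y_def by fastforce
      then show ?thesis using m by blast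
    qed
  qed
  then have X_span: "X \<subseteq> ratfun2.span ((\<lambda>m. zed ^ m) ` {..n})"
    using XY ratfun2.span_mono by blast
  let ?M = "laurent_mon 0 :: _ \<Rightarrow> 'k ratfun2"
  have zed_lower: "ratfun2.span ((\<lambda>m. zed ^ m) ` {..<m}) \<subseteq> ratfun2.span (?M ` below (int m,
      - int m))" for m
  proof (rule ratfun2.span_minimal)
    show "(\<lambda>m. zed ^ m) ` {..<m} \<subseteq> ratfun2.span (?M ` below (int m, - int m))"
    proof (rule image_subsetI)
      fix i assume "i \<in> {..<m}"
      then have "{h. fst h \<le> fst (int i, - int i)} \<subseteq> below (int m, - int m)"
        by (auto simp: below_def)
      then show "zed ^ i \<in> ratfun2.span (?M ` below (int m, - int m))"
        using has_gvector_in_span[OF has_gvector_zed_power] ratfun2.span_mono[OF image_mono]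
            by blast
    qed
  qed (rule ratfun2.subspace_span)
  have zed_lead: "zed ^ m - ?M (int m, - int m) \<in> ratfun2.span (?M ` below (int m, - int m))" for m
    by (rule has_gvector_below[OF has_gvector_zed_power])
  \<comment> \<open>Otherwise \<open>zed ^ n\<close> would be a combination of lower powers,
    contradicting its leading monomial.\<close>
  have "\<exists>b\<in>X. b \<notin> ratfun2.span ((\<lambda>m. zed ^ m) ` {..<n})"
  proof (rule ccontr)
    assume "\<not> ?thesis"
    then have "ratfun2.span X \<subseteq> ratfun2.span ((\<lambda>m. zed ^ m) ` {..<n})"
      by (intro ratfun2.span_minimal ratfun2.subspace_span) blast
    then have "zed ^ n \<in> ratfun2.span (?M ` below (int n, - int n))"
      using zX zed_lower by blast
    from ratfun2.span_diff[OF this zed_lead] have "(int n, - int n) \<in> below (int n, - int n)"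
      using laurent_mon_indep[where k = 0 and 'k = 'k] by simp
    then show False using below_irrefl by blast
  qed
  then obtain b where b: "b \<in> X" "b \<notin> ratfun2.span ((\<lambda>m. zed ^ m) ` {..<n})" by blast
  then have "b \<in> B" by (simp add: X_def)
  obtain \<rho> where \<rho>: "finite {m. \<rho> m \<noteq> 0}" "{m. \<rho> m \<noteq> 0} \<subseteq> {..n}" "b
      = (\<Sum>m | \<rho> m \<noteq> 0. kscale (\<rho> m) (zed ^ m))"
    using span_image_obtains[OF subsetD[OF X_span b(1)]] by blast
  have b_sum: "b = (\<Sum>m\<le>n. kscale (\<rho> m) (zed ^ m))"
    unfolding \<rho>(3) using \<rho>(2) by (intro sum.mono_neutral_left) auto
  have lower_sum: "(\<Sum>m<i. kscale (c m) (zed ^ m)) \<in> ratfun2.span ((\<lambda>m. zed ^ m) ` {..<i})" for i c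
    by (intro ratfun2.span_sum ratfun2.span_scale ratfun2.span_base) auto
  have lead: "(\<Sum>m\<le>i. kscale (c m) (zed ^ m)) - kscale (c i) (?M (int i, - int i))
      \<in> ratfun2.span (?M ` below (int i, - int i))" for i c
  proof -
    have "(\<Sum>m\<le>i. kscale (c m) (zed ^ m)) - kscale (c i) (?M (int i, - int i))
        = (\<Sum>m<i. kscale (c m) (zed ^ m)) + kscale (c i) (zed ^ i - ?M (int i, - int i))"
      by (simp add: ratfun2.scale_right_diff_distrib flip: lessThan_Suc_atMost)
    then show ?thesis
      using lower_sum[of c i] zed_lower[of i] zed_lead[of i]
          by (auto intro!: ratfun2.span_add ratfun2.span_scale)
  qed
  obtain g where g: "has_gvector 0 g b"
    using pointed_basis_gvector \<open>b \<in> B\<close> by blast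
  have "\<rho> n \<noteq> 0"
  proof
    assume "\<rho> n = 0"
    then have "b = (\<Sum>m<n. kscale (\<rho> m) (zed ^ m))"
      unfolding b_sum by (simp flip: lessThan_Suc_atMost)
    then show False
      using b(2) lower_sum by blast
  qed
  then have "g = (int n, - int n)" and \<rho>n: "\<rho> n = 1"
    using leading_coeff_unique[OF _ _ g, of "\<rho> n" "(int n, - int n)"] lead[of \<rho> n] b_sum by auto
  \<comment> \<open>Cone steps change the first exponent by even amounts, so a pointed element
    involves only exponents of one parity class.\<close>
  define E where "E i = {h :: int \<times> int. even (fst h - int i)}" for i
  have E_gvector: "f \<in> ratfun2.span (?M ` E i)" if "has_gvector 0 (int i, j) f" for f i j
  proof -
    have "cone (int i, j) \<subseteq> E i" by (auto simp: cone_def E_def)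
    then have "f - ?M (int i, j) \<in> ratfun2.span (?M ` E i)"
      using that ratfun2.span_mono[OF image_mono] unfolding has_gvector_iff by blast
    moreover have "?M (int i, j) \<in> ratfun2.span (?M ` E i)"
      by (intro ratfun2.span_base imageI) (simp add: E_def)
    ultimately show ?thesis
      by (metis ratfun2.span_add diff_add_cancel)
  qed
  have parity: "\<rho> m = 0" if "m \<le> n" "odd (n - m)" for m
  proof (rule ccontr)
    assume "\<rho> m \<noteq> 0"
    define c where "c m = (if odd (n - m) then \<rho> m else 0)" for m
    define c' where "c' m = (if odd (n - m) then 0 else \<rho> m)" for m
    define A where "A = {m. m \<le> n \<and> c m \<noteq> 0}"
    define i where "i = Max A"
    have "m \<in> A" "finite A"
      using \<open>\<rho> m \<noteq> 0\<close> that by (auto simp: A_def c_def)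
    then have i: "i \<in> A" "\<And>j. j \<in> A \<Longrightarrow> j \<le> i"
      unfolding i_def using Max_in by auto
    have "b = (\<Sum>m\<le>n. kscale (c m) (zed ^ m)) + (\<Sum>m\<le>n. kscale (c' m) (zed ^ m))"
      unfolding b_sum sum.distrib[symmetric] by (intro sum.cong) (auto simp: c_def c'_def)
    moreover have "(\<Sum>m\<le>n. kscale (c m) (zed ^ m)) = (\<Sum>m\<le>i. kscale (c m) (zed ^ m :: 'k ratfun2))"
      using i by (intro sum.mono_neutral_right) (fastforce simp: A_def)+
    \<comment> \<open>The part of \<open>b\<close> of the wrong parity is a difference of elements
      supported in \<open>E n\<close>, but its leading exponent \<open>(i, - i)\<close> lies outside
      \<open>E n\<close>.\<close>
    ultimately have eq: "(\<Sum>m\<le>i. kscale (c m) (zed ^ m)) = b - (\<Sum>m\<le>n. kscale (c' m) (zed ^ m))"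
      by simp
    have "b \<in> ratfun2.span (?M ` E n)"
      using E_gvector g \<open>g = _\<close> by blast
    moreover have "(\<Sum>m\<le>n. kscale (c' m) (zed ^ m)) \<in> ratfun2.span (?M ` E n)"
    proof (rule ratfun2.span_sum)
      fix m assume "m \<in> {..n}"
      show "kscale (c' m) (zed ^ m) \<in> ratfun2.span (?M ` E n)"
      proof (cases "odd (n - m)")
        case True
        then show ?thesis by (simp add: c'_def ratfun2.span_zero)
      next
        case False
        then have "E m = E n"
          using \<open>m \<in> {..n}\<close> by (auto simp: E_def)
        then show ?thesis
          using E_gvector[OF has_gvector_zed_power, of m] by (simp add: ratfun2.span_scale)
      qed
    qed
    ultimately have "(\<Sum>m\<le>i. kscale (c m) (zed ^ m)) \<in> ratfun2.span (?M ` E n)"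
      unfolding eq by (rule ratfun2.span_diff)
    then have "(\<Sum>m\<le>i. kscale (c m) (zed ^ m)) \<in> ratfun2.span (?M ` (E n \<union> below (int i, - int i)))"
      using ratfun2.span_mono[OF image_mono, of "E n" "E n \<union> below (int i, - int i)"] by blast
    moreover have "(\<Sum>m\<le>i. kscale (c m) (zed ^ m)) - kscale (c i) (?M (int i, - int i))
        \<in> ratfun2.span (?M ` (E n \<union> below (int i, - int i)))"
      using lead[of c i] ratfun2.span_mono[OF image_mono, of "below (int i, - int i)" "E n \<union> below
          (int i, - int i)"] by blast
    ultimately have "kscale (c i) (?M (int i, - int i))
        \<in> ratfun2.span (?M ` (E n \<union> below (int i, - int i)))"
      using ratfun2.span_diff by fastforce
    then have "kscale (inverse (c i)) (kscale (c i) (?M (int i, - int i)))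
        \<in> ratfun2.span (?M ` (E n \<union> below (int i, - int i)))"
      by (rule ratfun2.span_scale)
    then have "?M (int i, - int i) \<in> ratfun2.span (?M ` (E n \<union> below (int i, - int i)))"
      using i by (simp add: A_def)
    then have "(int i, - int i) \<in> E n \<union> below (int i, - int i)"
      using laurent_mon_indep[where k = 0 and 'k = 'k] by blast
    then have "even (int n - int i)"
      using below_irrefl by (auto simp: E_def)
    moreover have "i \<le> n" "odd (n - i)"
      using i(1) by (auto simp: A_def c_def split: if_splits)
    ultimately show False by auto
  qed
  have "b = imag_elem n (\<lambda>r. \<rho> (n - 2 * r))"
  proof -
    have "b = (\<Sum>m | m \<le> n \<and> even (n - m). kscale (\<rho> m) (zed ^ m))"
      unfolding b_sum using parity by (intro sum.mono_neutral_right) auto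
    also have "\<dots> = (\<Sum>r\<le>n div 2. kscale (\<rho> (n - 2 * r)) (zed ^ (n - 2 * r)))"
      by (rule sum.reindex_bij_witness[of _ "\<lambda>r. n - 2 * r" "\<lambda>m. (n - m) div 2"]) auto
    finally show ?thesis by (simp add: imag_elem_def)
  qed
  then show ?thesis
    using \<open>b \<in> B\<close> \<rho>n by (intro exI[of _ "\<lambda>r. \<rho> (n - 2 * r)"]) auto
qed

text \<open>One monic element of \<open>B\<close> for each degree, together with the cluster
  monomials, is already a linear basis; an independent set has no proper spanning subset.\<close>

lemma pointed_basis_is_monic_basis:
  obtains c where "\<And>n. n \<ge> 1 \<Longrightarrow> c n 0 = 1" "B = monic_basis c"
proof -
  obtain c where c: "\<And>n. n \<ge> 1 \<Longrightarrow> c n 0 = 1 \<and> imag_elem n (c n) \<in> B"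
    using imag_elem_in_pointed_basis by metis
  then have sub: "monic_basis c \<subseteq> B"
    using cluster_monomials_subset_pointed_basis by (auto simp: monic_basis_def)
  have "B \<subseteq> monic_basis c"
  proof (rule ccontr)
    assume "\<not> B \<subseteq> monic_basis c"
    then obtain b where b: "b \<in> B" "b \<notin> monic_basis c" by blast
    have "b \<in> ratfun2.span (monic_basis c)"
      using b(1) B linear_basis_monic_basis[of c] c
      unfolding pointed_basis_def pointed_def linear_basis_def by auto
    also have "\<dots> \<subseteq> ratfun2.span (B - {b})"
      using sub b by (intro ratfun2.span_mono) auto
    finally show False
      using b(1) B unfolding pointed_basis_def linear_basis_def ratfun2.dependent_def by blast
  qed
  then show ?thesis
    using sub c that by blast
qed

end

section \<open>The coefficients \<open>S_coeff\<close>\<close>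

lemma S_coeff_index_card:
  assumes "I \<subseteq> {1..n}" "J \<subseteq> {1..n}" "I \<inter> J = {}"
  shows "card I + card J \<le> n"
proof -
  have fin: "finite I" "finite J"
    using assms finite_subset by blast+
  then have "card I + card J = card (I \<union> J)"
    using assms by (simp add: card_Un_disjoint)
  also have "\<dots> \<le> card {1..n}"
    using assms by (intro card_mono) auto
  finally show ?thesis by simp
qed

lemma S_coeff_eq_0: "2 * r > n \<Longrightarrow> S_coeff n a r = 0"
proof -
  assume r: "2 * r > n"
  have "{(I, J). I \<subseteq> {1..n} \<and> J \<subseteq> {1..n} \<and> card I = r \<and> card J = r \<and> I \<inter> J = {}} = {}"
  proof -
    have False if "I \<subseteq> {1..n}" "J \<subseteq> {1..n}" "card I = r" "card J = r" "I \<inter> J = {}" for I J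
      using S_coeff_index_card[OF that(1,2,5)] that(3,4) r by simp
    then show ?thesis by blast
  qed
  then show ?thesis
    unfolding S_coeff_def by (simp only: sum.empty)
qed

lemma S_coeff_0: "S_coeff n a 0 = 1"
proof -
  have "{(I, J). I \<subseteq> {1..n} \<and> J \<subseteq> {1..n} \<and> card I = 0 \<and> card J = 0 \<and> I \<inter> J = {}} = {({}, {})}"
    by (auto dest: finite_subset)
  then show ?thesis
    by (simp add: S_coeff_def)
qed

text \<open>\<open>I\<close> and \<open>J\<close> collect the factors contributing \<open>f\<close>
  and \<open>h\<close>; the remaining factors contribute \<open>g\<close>.\<close>

lemma prod_trinomial:
  fixes f g h :: "'a \<Rightarrow> 'b::comm_semiring_1"
  assumes "finite X"
  shows "(\<Prod>i\<in>X. f i + (h i + g i))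
    = (\<Sum>(I, J)\<in>Sigma (Pow X) (\<lambda>I. Pow (X - I)). prod f I * (prod h J * prod g (X - I - J)))"
proof -
  have "(\<Prod>i\<in>X. f i + (h i + g i)) = (\<Sum>I\<in>Pow X. prod f I * (\<Prod>i\<in>X - I. h i + g i))"
    using assms by (rule prod_add)
  also have "\<dots> = (\<Sum>I\<in>Pow X. \<Sum>J\<in>Pow (X - I). prod f I * (prod h J * prod g (X - I - J)))"
    using assms by (intro sum.cong refl) (simp add: prod_add sum_distrib_left)
  also have "\<dots> = (\<Sum>(I, J)\<in>Sigma (Pow X) (\<lambda>I. Pow (X - I)). prod f I * (prod h J * prod g (X - I
      - J)))"
    using assms by (intro sum.Sigma) auto
  finally show ?thesis .
qed

lemma prod_monom:
  fixes c :: "'a \<Rightarrow> 'b::comm_semiring_1"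
  shows "(\<Prod>i\<in>X. monom (c i) m) = monom (\<Prod>i\<in>X. c i) (m * card X)"
  by (induction X rule: infinite_finite_induct) (simp_all add: mult_monom)

text \<open>
  The middle coefficient collects the choices of as many quadratic as constant terms.
\<close>

lemma coeff_trinomial_prod:
  fixes a :: "nat \<Rightarrow> 'k::field"
  assumes a: "\<And>i. i \<in> {1..n} \<Longrightarrow> a i \<noteq> 0"
  shows "coeff (\<Prod>i\<in>{1..n}. [:1, w * a i, (a i)\<^sup>2:]) n
    = (\<Prod>i\<in>{1..n}. a i) * (\<Sum>r\<le>n div 2. S_coeff n a r * w ^ (n - 2 * r))"
proof -
  define X where "X = {1..n}"
  define T where "T = Sigma (Pow X) (\<lambda>I. Pow (X - I))"
  define U where "U = {(I, J) \<in> T. card I = card J}"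
  have fin: "finite X" "finite T"
    by (auto simp: X_def T_def intro!: finite_SigmaI)
  then have finU: "finite U"
    by (rule_tac finite_subset[of U T]) (auto simp: U_def)
  have card: "card I + card J + card (X - I - J) = n" if "(I, J) \<in> T" for I J
  proof -
    have sub: "I \<subseteq> X" "J \<subseteq> X - I" using that by (auto simp: T_def)
    then have "card J + card (X - I - J) = card (X - I)" "card I + card (X - I) = card X"
      using fin(1) by (metis card_Diff_subset card_mono finite_Diff finite_subset
          le_add_diff_inverse)+
    then show ?thesis by (simp add: X_def)
  qed
  have coeff_term: "coeff ((\<Prod>i\<in>I. monom ((a i)\<^sup>2) 2) * ((\<Prod>j\<in>J. monom 1 0) * (\<Prod>i\<in>X - I - J. monom
      (w * a i) 1))) n
    = (if card I = card J then prod a X * (prod a I / prod a J * w ^ (n - 2 * card I)) else 0)"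
    if IJ: "(I, J) \<in> T" for I J
  proof -
    have "prod a X = prod a I * prod a (X - I)" "prod a (X - I) = prod a J * prod a (X - I - J)"
      using prod.subset_diff[of I X a] prod.subset_diff[of J "X - I" a] IJ fin(1)
      by (auto simp: T_def mult.commute)
    moreover have "prod a J \<noteq> 0"
    proof -
      have "J \<subseteq> X" using IJ by (auto simp: T_def)
      then show ?thesis
        using a finite_subset[OF _ fin(1), of J] by (auto simp: X_def)
    qed
    \<comment> \<open>The product of all \<open>a i\<close> cancels the denominator: indices in
      \<open>J\<close> drop out and those in \<open>I\<close> get squared, matching the constant and
      the quadratic terms.\<close>
    ultimately have prods: "prod a X * (prod a I / prod a J) = (prod a I)\<^sup>2 * prod a (X - I - J)"
      by (simp add: power2_eq_square)
    \<comment> \<open>Compare with \<open>card I + card J + card (X - I - J) = n\<close>.\<close>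
    have exps: "2 * card I + card (X - I - J) = n \<longleftrightarrow> card I = card J"
      "card I = card J \<Longrightarrow> card (X - I - J) = n - 2 * card I"
      using card[OF IJ] by linarith+
    have "coeff ((\<Prod>i\<in>I. monom ((a i)\<^sup>2) 2) * ((\<Prod>j\<in>J. monom 1 0) * (\<Prod>i\<in>X - I - J. monom (w
        * a i) 1))) n
        = (if card I = card J then (prod a I)\<^sup>2 * prod a (X - I - J) * w ^ card (X - I - J) else 0)"
      unfolding exps(1)[symmetric]
      by (simp add: prod_monom mult_monom prod.distrib mult_ac flip: prod_power_distrib)
    then show ?thesis
      using exps(2) by (simp flip: prods mult.assoc)
  qed
  have "(\<Prod>i\<in>{1..n}. [:1, w * a i, (a i)\<^sup>2:])
      = (\<Prod>i\<in>X. monom ((a i)\<^sup>2) 2 + (monom 1 0 + monom (w * a i) 1))"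
    by (simp add: X_def monom_altdef numeral_2_eq_2)
  also have "coeff \<dots> n
      = (\<Sum>(I, J)\<in>T. if card I
          = card J then prod a X * (prod a I / prod a J * w ^ (n - 2 * card I)) else 0)"
    unfolding prod_trinomial[OF fin(1)] coeff_sum T_def[symmetric]
    by (intro sum.cong refl) (auto simp only: coeff_term prod.case split_paired_all)
  also have "\<dots> = prod a X * (\<Sum>(I, J)\<in>U. prod a I / prod a J * w ^ (n - 2 * card I))"
    unfolding sum_distrib_left U_def using fin(2)
    by (intro sum.mono_neutral_cong_right) (auto split: if_splits)
  also have "(\<Sum>(I, J)\<in>U. prod a I / prod a J * w ^ (n - 2 * card I))
      = (\<Sum>r\<le>n div 2. \<Sum>(I, J)\<in>{x \<in> U. card (fst x) = r}. prod a I / prod a J * w ^ (n - 2 * card I))"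
  proof (rule sum.group[symmetric])
    show "(\<lambda>x. card (fst x)) ` U \<subseteq> {..n div 2}"
      using card by (fastforce simp: U_def)
  qed (use finU in auto)
  also have "\<dots> = (\<Sum>r\<le>n div 2. S_coeff n a r * w ^ (n - 2 * r))"
  proof (intro sum.cong refl)
    fix r
    have "{x \<in> U. card (fst x) = r}
        = {(I, J). I \<subseteq> {1..n} \<and> J \<subseteq> {1..n} \<and> card I = r \<and> card J = r \<and> I \<inter> J = {}}"
      by (auto simp: U_def T_def X_def)
    then show "(\<Sum>(I, J)\<in>{x \<in> U. card (fst x) = r}. prod a I / prod a J * w ^ (n - 2 * card I))
        = S_coeff n a r * w ^ (n - 2 * r)"
      unfolding S_coeff_def sum_distrib_right by (intro sum.cong) auto
  qed
  finally show ?thesis by (simp add: X_def)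
qed

text \<open>As the constant coefficient is 1, no root vanishes. Pulling \<open>x i\<close> out of
  each factor \<open>x i + u\<close> leaves \<open>1 + a i u\<close>, and the extracted scalars
  cancel the leading coefficient.\<close>

lemma splits_into_linear_factors:
  fixes E :: "'k::alg_closed_field poly"
  assumes deg: "degree E = n" and E0: "coeff E 0 = 1"
  obtains a where "E = (\<Prod>i\<in>{1..n}. [:1, a i:])" "\<And>i. i \<in> {1..n} \<Longrightarrow> a i \<noteq> 0"
proof -
  have "E \<noteq> 0" using E0 by auto
  then obtain A where A: "size A = n" "E = smult (lead_coeff E) (\<Prod>x\<in>#A. [:-x, 1:])"
    using alg_closed_imp_factorization deg by metis
  obtain xs where xs: "mset xs = A" using ex_mset by blast
  have len: "length xs = n" using A(1) xs by auto
  have E: "E = smult (lead_coeff E) (\<Prod>i\<in>{1..n}. [:- (xs ! (i - 1)), 1:])"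
  proof -
    have "(\<Prod>x\<in>#A. [:-x, 1:]) = (\<Prod>i\<in>{..<n}. [:- (xs ! i), 1:])"
      unfolding xs[symmetric] mset_map[symmetric] prod_mset_prod_list prod.list_conv_set_nth
      by (simp add: len atLeast0LessThan)
    also have "\<dots> = (\<Prod>i\<in>{1..n}. [:- (xs ! (i - 1)), 1:])"
      by (rule prod.reindex_bij_witness[of _ "\<lambda>i. i - 1" Suc]) auto
    finally show ?thesis using A(2) by simp
  qed
  define x where "x i = - (xs ! (i - 1))" for i
  have one: "lead_coeff E * (\<Prod>i\<in>{1..n}. x i) = 1"
    using arg_cong[OF E, of "\<lambda>p. poly p 0"] E0[folded poly_0_coeff_0]
    by (simp add: poly_prod x_def)
  then have nz: "x i \<noteq> 0" if "i \<in> {1..n}" for i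
    using that prod_zero_iff[of "{1..n}" x]
        by (metis finite_atLeastAtMost mult_zero_right zero_neq_one)
  have "(\<Prod>i\<in>{1..n}. [:x i, 1:]) = (\<Prod>i\<in>{1..n}. smult (x i) [:1, inverse (x i):])"
    using nz by (intro prod.cong refl) auto
  also have "\<dots> = smult (\<Prod>i\<in>{1..n}. x i) (\<Prod>i\<in>{1..n}. [:1, inverse (x i):])"
    by (rule prod_smult)
  finally have P: "(\<Prod>i\<in>{1..n}. [:x i, 1:])
      = smult (\<Prod>i\<in>{1..n}. x i) (\<Prod>i\<in>{1..n}. [:1, inverse (x i):])" .
  show ?thesis
    by (rule that[of "\<lambda>i. inverse (x i)"])
       (use nz E[folded x_def, unfolded P smult_smult one smult_1_left] in auto)
qed

section \<open>Prescribing the coefficients \<open>S_coeff\<close>\<close>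

text \<open>
  Put \<open>E = \<Prod>(1 + a\<^sub>i u) = \<Sum>e\<^sub>k u\<^sup>k\<close>.  For \<open>w = t + 1/t\<close> the trinomial product is
  \<open>E(tu) E(u/t)\<close>, whose middle coefficient is \<open>\<Sum>e\<^sub>k e\<^sub>n\<^sub>-\<^sub>k t\<^bsup>2k-n\<^esup>\<close>.  Hence only the products
  \<open>e\<^sub>k e\<^sub>n\<^sub>-\<^sub>k\<close> matter: they may be prescribed as any symmetric sequence \<open>d\<close> with \<open>d\<^sub>0 = 1\<close>, taking
  a square root for \<open>k = n/2\<close>.
\<close>

lemma S_coeff_surj:
  fixes c :: "nat \<Rightarrow> 'k::{alg_closed_field, field_char_0}"
  assumes n: "n \<ge> 1" and c0: "c 0 = 1"
  obtains a where "\<And>i. i \<in> {1..n} \<Longrightarrow> a i \<noteq> 0" "\<And>r. r \<le> n div 2 \<Longrightarrow> S_coeff n a r = c r"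
proof -
  \<comment> \<open>The coefficient of \<open>u^k\<close> in the sum of all
    \<open>c r * u^r * (1 + u)^(n - 2 * r)\<close>. The case distinction is needed because truncated
    subtraction would turn the binomial into 1 for \<open>r > k\<close>.\<close>
  define d where "d k = (\<Sum>r\<le>n div 2. c r * (if r
      \<le> k then of_nat ((n - 2 * r) choose (k - r)) else 0))" for k
  have d_sym: "d (n - k) = d k" if "k \<le> n" for k
    unfolding d_def
  proof (intro sum.cong refl arg_cong2[where f = "(*)"])
    fix r assume r: "r \<in> {..n div 2}"
    show "(if r \<le> n - k then of_nat ((n - 2 * r) choose (n - k - r)) else 0)
        = (if r \<le> k then of_nat ((n - 2 * r) choose (k - r)) else (0 :: 'k))"
    proof (cases "r \<le> k \<and> r \<le> n - k")
      case True
      then have "k - r \<le> n - 2 * r" "n - 2 * r - (k - r) = n - k - r"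
        using that by linarith+
      then have "(n - 2 * r) choose (k - r) = (n - 2 * r) choose (n - k - r)"
        by (metis binomial_symmetric)
      then show ?thesis using True by simp
    next
      case False
      then show ?thesis using r that by (auto simp: binomial_eq_0)
    qed
  qed
  have d0: "d 0 = 1"
  proof -
    have "d 0 = (\<Sum>r\<in>{0}. c r)"
      unfolding d_def by (intro sum.mono_neutral_cong_right) auto
    then show ?thesis using c0 by simp
  qed
  have d_gen: "(\<Sum>k\<le>n. d k * t ^ (2 * k))
      = (\<Sum>r\<le>n div 2. c r * (t ^ (2 * r) * (t\<^sup>2 + 1) ^ (n - 2 * r)))" for t
  proof -
    have "(\<Sum>k\<le>n. d k * t ^ (2 * k))
        = (\<Sum>r\<le>n div 2. \<Sum>k\<le>n. c r * ((if r
            \<le> k then of_nat ((n - 2 * r) choose (k - r)) else 0) * t ^ (2 * k)))"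
      unfolding d_def sum_distrib_right by (subst sum.swap) (simp add: mult.assoc)
    also have "\<dots> = (\<Sum>r\<le>n div 2. c r * (t ^ (2 * r) * (t\<^sup>2 + 1) ^ (n - 2 * r)))"
    proof (intro sum.cong refl)
      fix r assume "r \<in> {..n div 2}"
      then have r: "2 * r \<le> n" by auto
      have "(\<Sum>k\<le>n. (if r \<le> k then of_nat ((n - 2 * r) choose (k - r)) else 0) * t ^ (2 * k))
          = (\<Sum>k\<in>{r..n - r}. of_nat ((n - 2 * r) choose (k - r)) * t ^ (2 * k))"
        using r by (intro sum.mono_neutral_cong_right) (auto simp: binomial_eq_0)
      also have "\<dots> = (\<Sum>j\<le>n - 2 * r. of_nat ((n - 2 * r) choose j) * t ^ (2 * (j + r)))"
        by (rule sum.reindex_bij_witness[of _ "\<lambda>j. j + r" "\<lambda>k. k - r"]) (use r in auto)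
      also have "\<dots> = t ^ (2 * r) * (t\<^sup>2 + 1) ^ (n - 2 * r)"
        unfolding power_mult[of t 2] by (simp add: binomial_ring sum_distrib_left power_add mult_ac)
      finally show "(\<Sum>k\<le>n. c r * ((if r
          \<le> k then of_nat ((n - 2 * r) choose (k - r)) else 0) * t ^ (2 * k)))
          = c r * (t ^ (2 * r) * (t\<^sup>2 + 1) ^ (n - 2 * r))"
        by (simp flip: sum_distrib_left)
    qed
    finally show ?thesis .
  qed
  obtain s where s: "s ^ 2 = d (n div 2)"
    using nth_root_exists[of 2 "d (n div 2)"] by auto
  define e where "e k = (if 2 * k < n then 1 else if 2 * k = n then s else d k)" for k
  have ee: "e k * e (n - k) = d k" if "k \<le> n" for k
  proof -
    consider "2 * k < n" | "2 * k = n" | "2 * k > n" by linarith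
    then show ?thesis
    proof cases
      case 2
      then have "n - k = k" "n div 2 = k" by auto
      then show ?thesis using 2 s by (simp add: e_def power2_eq_square)
    qed (use d_sym[OF that] that in \<open>auto simp: e_def\<close>)
  qed
  \<comment> \<open>These two values give \<open>E\<close> degree \<open>n\<close> and constant term
    1, and make the product of the \<open>a i\<close> equal to 1, which removes the prefactor in
    \<open>coeff_trinomial_prod\<close>.\<close>
  have en: "e n = 1" and e0: "e 0 = 1"
    using n d_sym[of 0] d0 by (auto simp: e_def)
  define E where "E = (\<Sum>k\<le>n. monom (e k) k)"
  have coeff_E: "coeff E k = (if k \<le> n then e k else 0)" for k
    by (simp add: E_def coeff_sum)
  have "degree E = n"
    by (rule antisym) (auto intro!: degree_le le_degree simp: coeff_E en)
  moreover have "coeff E 0 = 1"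
    by (simp add: coeff_E e0)
  ultimately obtain a where a: "E = (\<Prod>i\<in>{1..n}. [:1, a i:])" "\<And>i. i \<in> {1..n} \<Longrightarrow> a i \<noteq> 0"
    by (rule splits_into_linear_factors) blast
  have prod_a: "(\<Prod>i\<in>{1..n}. a i) = 1"
  proof -
    have "lead_coeff E = (\<Prod>i\<in>{1..n}. a i)"
      unfolding a(1) lead_coeff_prod using a(2) by (intro prod.cong) auto
    then show ?thesis
      using \<open>degree E = n\<close> by (simp add: coeff_E en)
  qed
  have eq: "(\<Sum>r\<le>n div 2. S_coeff n a r * (t + 1 / t) ^ (n - 2 * r))
      = (\<Sum>r\<le>n div 2. c r * (t + 1 / t) ^ (n - 2 * r))"
    if t: "t \<noteq> 0" for t
  proof -
    have comp: "(\<Prod>i\<in>{1..n}. [:1, a i * t:]) = pcompose E [:0, t:]" for t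
      by (simp add: a(1) pcompose_prod pcompose_pCons mult.commute)
    have "(\<Prod>i\<in>{1..n}. [:1, (t + 1 / t) * a i, (a i)\<^sup>2:])
        = (\<Prod>i\<in>{1..n}. [:1, a i * t:]) * (\<Prod>i\<in>{1..n}. [:1, a i * (1 / t):])"
      unfolding prod.distrib[symmetric] using t
      by (intro prod.cong refl) (simp add: field_simps power2_eq_square)
    also have "coeff \<dots> n = (\<Sum>k\<le>n. t ^ k * e k * ((1 / t) ^ (n - k) * e (n - k)))"
      unfolding comp coeff_mult coeff_pcompose_linear by (intro sum.cong) (auto simp: coeff_E)
    also have "\<dots> * t ^ n = (\<Sum>k\<le>n. d k * t ^ (2 * k))"
      unfolding sum_distrib_right
    proof (intro sum.cong refl)
      fix k assume "k \<in> {..n}"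
      then have tn: "t ^ n = t ^ (n - k) * t ^ k" and ek: "e k * e (n - k) = d k"
        using ee by (simp_all flip: power_add)
      have "t ^ k * e k * ((1 / t) ^ (n - k) * e (n - k)) * t ^ n
          = (e k * e (n - k)) * (t ^ k * t ^ k) * ((1 / t) ^ (n - k) * t ^ (n - k))"
        unfolding tn by (simp only: mult_ac)
      also have "(1 / t) ^ (n - k) * t ^ (n - k) = 1"
        using t by (simp flip: power_mult_distrib)
      finally show "t ^ k * e k * ((1 / t) ^ (n - k) * e (n - k)) * t ^ n = d k * t ^ (2 * k)"
        by (simp add: ek mult_2 power_add)
    qed
    also have "\<dots> = (\<Sum>r\<le>n div 2. c r * (t + 1 / t) ^ (n - 2 * r)) * t ^ n"
      unfolding d_gen sum_distrib_right
    proof (intro sum.cong refl)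
      fix r assume "r \<in> {..n div 2}"
      then have "t ^ n = t ^ (n - 2 * r) * t ^ (2 * r)"
        by (simp flip: power_add)
      moreover have "(t + 1 / t) * t = t\<^sup>2 + 1"
        using t by (simp add: field_simps power2_eq_square)
      ultimately show "c r * (t ^ (2 * r) * (t\<^sup>2 + 1) ^ (n - 2 * r))
          = c r * (t + 1 / t) ^ (n - 2 * r) * t ^ n"
        by (simp add: mult_ac flip: power_mult_distrib)
    qed
    finally show ?thesis
      using t coeff_trinomial_prod[of n a "t + 1 / t"] a(2) prod_a by simp
  qed
  \<comment> \<open>Every \<open>w\<close> has the form \<open>t + 1/t\<close> with \<open>t\<close>
    a root of \<open>t^2 - w t + 1\<close>, so \<open>P\<close> vanishes on an infinite
    field.\<close>
  define P where "P = (\<Sum>r\<le>n div 2. monom (S_coeff n a r - c r) (n - 2 * r))"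
  have "poly P w = 0" for w
  proof -
    obtain t where "poly [:1, - w, 1:] t = 0"
      using alg_closed_imp_poly_has_root[of "[:1, - w, 1:]"] by auto
    then have t: "t * t - w * t + 1 = 0" by (simp add: algebra_simps)
    then have "t \<noteq> 0" by auto
    moreover have "w = t + 1 / t"
      using t \<open>t \<noteq> 0\<close> by (simp add: field_simps)
    ultimately show ?thesis
      using eq[of t] by (simp add: P_def poly_sum poly_monom left_diff_distrib sum_subtractf)
  qed
  then have "P = 0"
    using poly_all_0_iff_0 by blast
  have "S_coeff n a r = c r" if "r \<le> n div 2" for r
  proof -
    have "coeff P (n - 2 * r) = (\<Sum>i\<in>{r}. S_coeff n a i - c i)"
      unfolding P_def coeff_sum by (intro sum.mono_neutral_cong_right)
          (use that in \<open>auto split: if_splits\<close>)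
    then show ?thesis
      using \<open>P = 0\<close> by simp
  qed
  then show ?thesis
    using that a(2) by blast
qed

section \<open>The elements \<open>x_imag\<close> as polynomials in \<open>zed\<close>\<close>

lemma const_of_nat: "const (of_nat m :: 'k::field) = of_nat m"
  by (induction m) (simp_all add: const_add)

text \<open>After the shift \<open>l = r + j\<close> the sum over \<open>k\<close> yields a power of
  \<open>1 + X\<^sup>2\<close>; the sum over \<open>j\<close> then combines it with
  \<open>Y\<^sup>2\<close>.\<close>

lemma double_binomial_sum:
  fixes X Y :: "'a::comm_ring_1"
  assumes r: "2 * r \<le> n"
  shows "(\<Sum>l\<in>{r..n}. \<Sum>k\<le>l. of_nat ((l - r) choose k) * of_nat ((n - 2 * r) choose (l - r))
            * X ^ (2 * (l - k)) * Y ^ (2 * (n - l)))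
    = (X * Y) ^ (2 * r) * (X\<^sup>2 + Y\<^sup>2 + 1) ^ (n - 2 * r)"
proof -
  define m where "m = n - 2 * r"
  have inner: "(\<Sum>k\<le>r + j. of_nat (j choose k) * X ^ (2 * (r + j - k)))
      = X ^ (2 * r) * (1 + X\<^sup>2) ^ j" for j
  proof -
    have "(\<Sum>k\<le>r + j. of_nat (j choose k) * X ^ (2 * (r + j - k)))
        = (\<Sum>k\<le>j. X ^ (2 * r) * (of_nat (j choose k) * 1 ^ k * (X\<^sup>2) ^ (j - k)))"
    proof (rule sum.mono_neutral_cong_right)
      show "of_nat (j choose k) * X ^ (2 * (r + j - k))
          = X ^ (2 * r) * (of_nat (j choose k) * 1 ^ k * (X\<^sup>2) ^ (j - k))"
        if "k \<in> {..j}" for k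
      proof -
        have "2 * (r + j - k) = 2 * r + 2 * (j - k)" using that by auto
        then have "X ^ (2 * (r + j - k)) = X ^ (2 * r) * (X\<^sup>2) ^ (j - k)"
          by (simp only: power_add power_mult)
        then show ?thesis by (simp add: mult_ac)
      qed
    qed (auto simp: binomial_eq_0)
    then show ?thesis
      by (simp add: binomial_ring sum_distrib_left)
  qed
  have "(\<Sum>l\<in>{r..n}. \<Sum>k\<le>l. of_nat ((l - r) choose k) * of_nat (m choose (l - r))
            * X ^ (2 * (l - k)) * Y ^ (2 * (n - l)))
    = (\<Sum>l\<in>{r..n}. of_nat (m choose (l - r)) * Y ^ (2 * (n - l)) * (\<Sum>k\<le>l. of_nat ((l - r) choose k)
        * X ^ (2 * (l - k))))"
    by (simp add: sum_distrib_left mult_ac)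
  \<comment> \<open>The bound \<open>r + m\<close> is \<open>n - r\<close>; beyond it
    \<open>m choose (l - r)\<close> vanishes.\<close>
  also have "\<dots> = (\<Sum>l\<in>{r..r + m}. of_nat (m choose (l - r)) * Y ^ (2 * (n - l)) * (\<Sum>k\<le>l. of_nat ((l
      - r) choose k) * X ^ (2 * (l - k))))"
    using r by (intro sum.mono_neutral_right) (auto simp: m_def binomial_eq_0)
  also have "\<dots> = (\<Sum>j\<le>m. of_nat (m choose j) * Y ^ (2 * (n - (r + j))) * (\<Sum>k\<le>r + j. of_nat
      (j choose k) * X ^ (2 * (r + j - k))))"
    by (rule sum.reindex_bij_witness[of _ "\<lambda>j. r + j" "\<lambda>l. l - r"]) auto
  also have "\<dots> = (\<Sum>j\<le>m. (X * Y) ^ (2 * r) * (of_nat (m choose j) * (1 + X\<^sup>2) ^ j * (Y\<^sup>2) ^ (m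
      - j)))"
  proof (intro sum.cong refl)
    fix j assume "j \<in> {..m}"
    then have "2 * (n - (r + j)) = 2 * r + 2 * (m - j)" using r by (auto simp: m_def)
    then have "Y ^ (2 * (n - (r + j))) = Y ^ (2 * r) * (Y\<^sup>2) ^ (m - j)"
      by (simp only: power_add power_mult)
    then show "of_nat (m choose j) * Y ^ (2 * (n - (r + j))) * (\<Sum>k\<le>r + j. of_nat (j choose k)
        * X ^ (2 * (r + j - k)))
        = (X * Y) ^ (2 * r) * (of_nat (m choose j) * (1 + X\<^sup>2) ^ j * (Y\<^sup>2) ^ (m - j))"
      unfolding inner by (simp add: power_mult_distrib mult_ac)
  qed
  also have "\<dots> = (X * Y) ^ (2 * r) * (1 + X\<^sup>2 + Y\<^sup>2) ^ m"
    by (simp add: binomial_ring[of "1 + X\<^sup>2" "Y\<^sup>2"] sum_distrib_left)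
  finally show ?thesis
    by (simp add: m_def add_ac)
qed

text \<open>With \<open>r\<close> moved outermost, the double binomial sum for \<open>r\<close>
  becomes \<open>zed ^ (n - 2 * r)\<close> times \<open>(X * Y) ^ n\<close>, which the monomial
  prefactor cancels. Terms with \<open>2 * r > n\<close> vanish with \<open>S_coeff\<close>.\<close>

lemma x_imag_eq: "x_imag n a = imag_elem n (S_coeff n (a :: nat \<Rightarrow> 'k::field_char_0))"
proof -
  define X Y :: "'k ratfun2" where "X = cluster_var 0" and "Y = cluster_var 1"
  have nz: "X \<noteq> 0" "Y \<noteq> 0" by (simp_all add: X_def Y_def cluster_var_nonzero)
  define t where "t r l k = of_nat ((l - r) choose k) * of_nat ((n - 2 * r) choose (l - r))
            * X ^ (2 * (l - k)) * Y ^ (2 * (n - l))" for r l k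
  have "(\<Sum>l = 0..n. \<Sum>k = 0..l. \<Sum>r = 0..l.
        const (of_nat ((l - r) choose k) * of_nat ((n - 2 * r) choose (l - r)) * S_coeff n a r)
        * X ^ (2 * (l - k)) * Y ^ (2 * (n - l)))
    = (\<Sum>l\<le>n. \<Sum>r | r \<in> {..n} \<and> r \<le> l. \<Sum>k\<le>l. kscale (S_coeff n a r) (t r l k))"
  proof (rule sum.cong)
    fix l assume l: "l \<in> {..n}"
    have "(\<Sum>k = 0..l. \<Sum>r
        = 0..l. const (of_nat ((l - r) choose k) * of_nat ((n - 2 * r) choose (l - r))
            * S_coeff n a r)
        * X ^ (2 * (l - k)) * Y ^ (2 * (n - l)))
      = (\<Sum>k\<le>l. \<Sum>r\<le>l. kscale (S_coeff n a r) (t r l k))"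
      by (simp add: atLeast0AtMost kscale_def t_def const_mult const_of_nat mult_ac)
    also have "\<dots> = (\<Sum>r\<le>l. \<Sum>k\<le>l. kscale (S_coeff n a r) (t r l k))"
      by (rule sum.swap)
    finally have "(\<Sum>k = 0..l. \<Sum>r
        = 0..l. const (of_nat ((l - r) choose k) * of_nat ((n - 2 * r) choose (l - r))
            * S_coeff n a r)
        * X ^ (2 * (l - k)) * Y ^ (2 * (n - l))) = \<dots>" .
    moreover have "{r. r \<in> {..n} \<and> r \<le> l} = {..l}"
      using l by auto
    ultimately show "(\<Sum>k = 0..l. \<Sum>r
        = 0..l. const (of_nat ((l - r) choose k) * of_nat ((n - 2 * r) choose (l - r))
            * S_coeff n a r)
        * X ^ (2 * (l - k)) * Y ^ (2 * (n - l)))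
      = (\<Sum>r | r \<in> {..n} \<and> r \<le> l. \<Sum>k\<le>l. kscale (S_coeff n a r) (t r l k))"
      by (simp only:)
  qed (simp add: atLeast0AtMost)
  also have "\<dots> = (\<Sum>r\<le>n. \<Sum>l | l \<in> {..n} \<and> r \<le> l. \<Sum>k\<le>l. kscale (S_coeff n a r) (t r l k))"
    by (rule sum.swap_restrict) auto
  also have "\<dots> = (\<Sum>r\<le>n div 2. kscale (S_coeff n a r) ((X * Y) ^ (2 * r) * (X\<^sup>2 + Y\<^sup>2 + 1) ^ (n - 2
      * r)))"
  proof (rule sum.mono_neutral_cong_right)
    fix r assume r: "r \<in> {..n div 2}"
    have "{l. l \<in> {..n} \<and> r \<le> l} = {r..n}" by auto
    then have "(\<Sum>l | l \<in> {..n} \<and> r \<le> l. \<Sum>k\<le>l. kscale (S_coeff n a r) (t r l k))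
        = kscale (S_coeff n a r) (\<Sum>l\<in>{r..n}. \<Sum>k\<le>l. t r l k)"
      by (simp add: kscale_def sum_distrib_left)
    also have "(\<Sum>l\<in>{r..n}. \<Sum>k\<le>l. t r l k) = (X * Y) ^ (2 * r) * (X\<^sup>2 + Y\<^sup>2 + 1) ^ (n - 2 * r)"
      unfolding t_def by (rule double_binomial_sum) (use r in auto)
    finally show "(\<Sum>l | l \<in> {..n} \<and> r \<le> l. \<Sum>k\<le>l. kscale (S_coeff n a r) (t r l k))
        = kscale (S_coeff n a r) ((X * Y) ^ (2 * r) * (X\<^sup>2 + Y\<^sup>2 + 1) ^ (n - 2 * r))" .
  next
    show "\<forall>r\<in>{..n} - {..n div 2}. (\<Sum>l | l \<in> {..n} \<and> r \<le> l. \<Sum>k\<le>l. kscale (S_coeff n a r) (t r l k))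
        = 0"
    proof
      fix r assume "r \<in> {..n} - {..n div 2}"
      then have "S_coeff n a r = 0" by (intro S_coeff_eq_0) auto
      then show "(\<Sum>l | l \<in> {..n} \<and> r \<le> l. \<Sum>k\<le>l. kscale (S_coeff n a r) (t r l k)) = 0"
        by simp
    qed
  qed auto
  finally have "x_imag n a = X powi (- int n) * Y powi (- int n)
      * (\<Sum>r\<le>n div 2. kscale (S_coeff n a r) ((X * Y) ^ (2 * r) * (X\<^sup>2 + Y\<^sup>2 + 1) ^ (n - 2 * r)))"
    unfolding x_imag_def X_def Y_def by simp
  also have "\<dots> = imag_elem n (S_coeff n a)"
    unfolding imag_elem_def sum_distrib_left
  proof (intro sum.cong refl)
    fix r assume "r \<in> {..n div 2}"
    then have n: "(X * Y) ^ n = (X * Y) ^ (2 * r) * (X * Y) ^ (n - 2 * r)"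
      by (simp flip: power_add)
    have "X\<^sup>2 + Y\<^sup>2 + 1 = zed * (X * Y)"
      using nz by (simp add: zed_def X_def Y_def)
    then have "(X * Y) ^ (2 * r) * (X\<^sup>2 + Y\<^sup>2 + 1) ^ (n - 2 * r) = zed ^ (n - 2 * r) * (X * Y) ^ n"
      unfolding n by (simp add: power_mult_distrib mult_ac)
    moreover have "X powi (- int n) * Y powi (- int n) * (X * Y) ^ n = 1"
      using nz by (simp add: power_int_minus power_mult_distrib field_simps)
    ultimately show "X powi (- int n) * Y powi (- int n)
        * kscale (S_coeff n a r) ((X * Y) ^ (2 * r) * (X\<^sup>2 + Y\<^sup>2 + 1) ^ (n - 2 * r))
      = kscale (S_coeff n a r) (zed ^ (n - 2 * r))"
      by (simp add: kscale_mult_right mult_ac)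
  qed
  finally show ?thesis .
qed

lemma basis_at_eq: "basis_at a = monic_basis (\<lambda>n. S_coeff n (a n :: nat \<Rightarrow> 'k::field_char_0))"
  by (simp add: basis_at_def monic_basis_def x_imag_eq)

theorem theorem7p4:
  shows "(\<forall>a \<in> torus_points. linear_basis (basis_at a :: 'k::{alg_closed_field, field_char_0} ratfun2 set))
       \<and> {basis_at a | a. a \<in> torus_points} = {B :: 'k ratfun2 set. pointed_basis B}"
proof (intro conjI ballI equalityI subsetI)
  fix a :: "nat \<Rightarrow> nat \<Rightarrow> 'k"
  show "linear_basis (basis_at a)"
    unfolding basis_at_eq by (rule linear_basis_monic_basis) (rule S_coeff_0)
next
  fix B :: "'k ratfun2 set"
  assume "B \<in> {basis_at a | a. a \<in> torus_points}"
  then obtain a where "B = basis_at a" by blast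
  then show "B \<in> {B. pointed_basis B}"
    unfolding basis_at_eq by (simp add: pointed_basis_monic_basis S_coeff_0)
next
  fix B :: "'k ratfun2 set"
  assume "B \<in> {B. pointed_basis B}"
  then obtain c where c: "\<And>n. n \<ge> 1 \<Longrightarrow> c n 0 = 1" "B = monic_basis c"
    using pointed_basis_is_monic_basis by blast
  \<comment> \<open>Different degrees do not interact, so a point of the torus is chosen separately
    for each \<open>n\<close>.\<close>
  have "\<exists>a. (\<forall>i\<in>{1..n}. a i \<noteq> 0) \<and> (\<forall>r\<le>n div 2. S_coeff n a r = c n r)" if "n \<ge> 1" for n
    using S_coeff_surj[of n "c n"] c(1)[OF that] that by metis
  then obtain a where a: "\<And>n. n \<ge> 1 \<Longrightarrow> (\<forall>i\<in>{1..n}. a n i \<noteq> 0) \<and> (\<forall>r\<le>n div 2. S_coeff n (a n) r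
      = c n r)"
    by metis
  then have "imag_elem n (S_coeff n (a n)) = imag_elem n (c n)" if "n \<ge> 1" for n
    using that by (intro imag_elem_cong) blast
  then have "B = basis_at a"
    unfolding c(2) basis_at_eq monic_basis_def by (intro arg_cong2[where f = "(\<union>)"] refl) force
  moreover have "a \<in> torus_points"
    using a by (simp add: torus_points_def)
  ultimately show "B \<in> {basis_at a | a. a \<in> torus_points}"
    by blast
qed

end
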